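(* Let $R=\mathbb{C}[x,y,z]$ and, for positive integers $r,d$, let $\operatorname{Quot}_r^d\mathbb{A}^3$ be the Quot scheme parametrising quotients $R^{\oplus r}\twoheadrightarrow M$ with $\dim_{\mathbb{C}} M=d$ (equivalently, submodules $K\subset R^{\oplus r}$ with $\dim_{\mathbb{C}}R^{\oplus r}/K=d$). Suppose that either $r=1$ and $d\geqslant 12$, or $r\geqslant 2$ and $d\geqslant 8$. Then there exists a point $[0\to K\to R^{\oplus r}\to M\to 0]\in\operatorname{Quot}_r^d\mathbb{A}^3$ such that \[ \dim_{\mathbb{C}}\mathsf T_{[M]}\operatorname{Quot}_r^d\mathbb{A}^3=\dim_{\mathbb{C}}\operatorname{Hom}_R(K,M)\not\equiv r\cdot d \pmod 2. \] In particular, the parity conjecture (which asserts that for every irreducible smooth threefold $X$ and every $[\mathcal F]\in\operatorname{Quot}_r^dX$ one has $\dim_{\mathbb{C}}\mathsf T_{[\mathcal F]}\operatorname{Quot}_r^dX\equiv r d\pmod 2$) is false for all such $(r,d)$.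
   Context: The tangent space to the Quot scheme at a point $[0\to K\to R^{\oplus r}\to M\to 0]$ is identified with $\operatorname{Hom}_R(K,M)$. Everything is over $\mathbb{C}$. *)

theory Defs
  imports Complex_Main "HOL-Library.Poly_Mapping" "HOL-Library.Product_Plus" "HOL-Library.Function_Algebras"
begin

text \<open>The polynomial ring R = C[x,y,z]: finitely supported maps from exponent
  triples (a,b,c) (the monomial x^a y^b z^c) to complex coefficients, with
  convolution product.\<close>
type_synonym poly3 = "(nat \<times> nat \<times> nat) \<Rightarrow>\<^sub>0 complex"

text \<open>Vectors of R^r are represented as maps nat to poly3 vanishing at indices \<ge> r.\<close>
type_synonym vec3 = "nat \<Rightarrow> poly3"

definition free_module :: "nat \<Rightarrow> vec3 set" where
  "free_module r = {v. \<forall>i\<ge>r. v i = 0}"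

definition rmult :: "poly3 \<Rightarrow> vec3 \<Rightarrow> vec3" where
  "rmult f v = (\<lambda>i. f * v i)"

definition const3 :: "complex \<Rightarrow> poly3" where
  "const3 c = Poly_Mapping.single 0 c"

definition is_submodule :: "nat \<Rightarrow> vec3 set \<Rightarrow> bool" where
  "is_submodule r K \<longleftrightarrow> K \<subseteq> free_module r \<and> 0 \<in> K \<and>
     (\<forall>u\<in>K. \<forall>v\<in>K. u + v \<in> K) \<and> (\<forall>f. \<forall>v\<in>K. rmult f v \<in> K)"

text \<open>Dimension of a quotient of complex vector spaces V/N (N \<subseteq> V subspaces of an
  abelian group with complex scalar action sm): V/N has a basis of n elements.\<close>
definition quot_dim :: "(complex \<Rightarrow> 'a::ab_group_add \<Rightarrow> 'a) \<Rightarrow> 'a set \<Rightarrow> 'a set \<Rightarrow> nat \<Rightarrow> bool" where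
  "quot_dim sm V N n \<longleftrightarrow> (\<exists>b::nat \<Rightarrow> 'a. (\<forall>i<n. b i \<in> V) \<and>
     (\<forall>c::nat \<Rightarrow> complex. (\<Sum>i<n. sm (c i) (b i)) \<in> N \<longrightarrow> (\<forall>i<n. c i = 0)) \<and>
     (\<forall>v\<in>V. \<exists>c::nat \<Rightarrow> complex. v - (\<Sum>i<n. sm (c i) (b i)) \<in> N))"

definition vsmult :: "complex \<Rightarrow> vec3 \<Rightarrow> vec3" where
  "vsmult c v = rmult (const3 c) v"

definition hsmult :: "complex \<Rightarrow> (vec3 \<Rightarrow> vec3) \<Rightarrow> (vec3 \<Rightarrow> vec3)" where
  "hsmult c \<phi> = (\<lambda>k. vsmult c (\<phi> k))"

text \<open>Hom_R(K, R^r/K), represented by lifts: set maps \<phi> : K \<rightarrow> R^r (extended by 0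
  outside K) that are R-linear modulo K; two lifts define the same homomorphism iff
  their difference takes values in K.  So Hom_R(K,M) = hom_lifts / hom_null.\<close>
definition hom_lifts :: "nat \<Rightarrow> vec3 set \<Rightarrow> (vec3 \<Rightarrow> vec3) set" where
  "hom_lifts r K = {\<phi>. (\<forall>k. k \<notin> K \<longrightarrow> \<phi> k = 0) \<and> (\<forall>k\<in>K. \<phi> k \<in> free_module r) \<and>
     (\<forall>k\<in>K. \<forall>l\<in>K. \<phi> (k + l) - \<phi> k - \<phi> l \<in> K) \<and>
     (\<forall>f. \<forall>k\<in>K. \<phi> (rmult f k) - rmult f (\<phi> k) \<in> K)}"

definition hom_null :: "nat \<Rightarrow> vec3 set \<Rightarrow> (vec3 \<Rightarrow> vec3) set" where
  "hom_null r K = {\<phi> \<in> hom_lifts r K. \<forall>k. \<phi> k \<in> K}"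

end

theory Submission
  imports Defs
begin

text \<open>
  For a point of the Quot scheme the parity of \<open>dim Hom(K, M) - r d\<close> is unchanged by adding a free
  summand to \<open>K\<close> (the dimension grows by \<open>d\<close>) and by adding a reduced point outside the support of
  \<open>M\<close> (it grows by \<open>r + 2\<close>). Hence two explicit points suffice. For \<open>(r, d) = (1, 12)\<close> take the ideal
  \<open>(x, y\<^sup>2, yz, z\<^sup>2)\<^sup>2 + (y\<^sup>3 - xz)\<close>; for \<open>(r, d) = (2, 8)\<close> take the module with generators \<open>e, f\<close> and
  \<open>xf = 0\<close>, \<open>yf = xe\<close>, \<open>zf = y\<^sup>2e\<close>, \<open>m\<^sup>2f = 0\<close>, \<open>x m e = 0\<close>, \<open>(y, z)\<^sup>3e = 0\<close>. In both cases \<open>K\<close> has eight minimal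
  generators, and a basis of \<open>Hom(K, M)\<close> consists of the maps sending one generator to a socle element
  and the others to zero (40 and 32 of them), further maps of this kind with values outside the socle
  (4 and 6), and the derivation \<open>d/dx\<close>; so the dimensions are 45 and 39.
\<close>

section \<open>Polynomials in three variables\<close>

text \<open>Adding a free summand turns Hom(K, M) into the direct sum of Hom(K, M) and M. The r + 2
  of a new reduced point is the tangent dimension of the length-one Quot scheme: 3 for moving the
  point and r - 1 for moving the quotient line. So the odd numbers 45 + 12 and 39 + 16 keep their
  parity. In both examples put J = (x, y^2, yz, z^2). A generator that enters the syzygies only with
  coefficients in J may be sent to any element of M killed by J while the others go to zero; this is
  where the 4 and 6 maps with values outside the socle come from. The formal obstacle is that M and
  Hom(K, M) are given by representatives, so that identities hold only modulo K. Dimensions are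
  therefore handled through coordinate functions that are linear on representatives and vanish
  exactly on the trivial ones. Dual elements show that the coordinates are independent, syzygies
  show that there are enough of them.\<close>

definition xv :: poly3 where "xv = Poly_Mapping.single (1, 0, 0) 1"
definition yv :: poly3 where "yv = Poly_Mapping.single (0, 1, 0) 1"
definition zv :: poly3 where "zv = Poly_Mapping.single (0, 0, 1) 1"

abbreviation lookup3 :: "poly3 \<Rightarrow> nat \<times> nat \<times> nat \<Rightarrow> complex" where
  "lookup3 \<equiv> Poly_Mapping.lookup"

text \<open>By cancellation n is the only exponent that m shifts to m + n, so the convolution has a
  single term.\<close>

lemma lookup_single_times:
  fixes f :: "'a::cancel_comm_monoid_add \<Rightarrow>\<^sub>0 'b::comm_semiring_1"
  shows "Poly_Mapping.lookup (Poly_Mapping.single m c * f) (m + n) = c * Poly_Mapping.lookup f n"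
proof -
  have "Poly_Mapping.lookup (Poly_Mapping.single m c * f) (m + n)
      = (\<Sum>l. (c * (\<Sum>q. Poly_Mapping.lookup f q when m + n = l + q)) when l = m)"
    unfolding lookup_mult by (rule Sum_any.cong) (auto simp: lookup_single when_def)
  also have "\<dots> = c * (\<Sum>q. Poly_Mapping.lookup f q when n = q)"
    by simp
  finally show ?thesis by simp
qed

lemma lookup_single_times_eq_0:
  fixes f :: "'a::cancel_comm_monoid_add \<Rightarrow>\<^sub>0 'b::comm_semiring_1"
  assumes "\<And>n. k \<noteq> m + n"
  shows "Poly_Mapping.lookup (Poly_Mapping.single m c * f) k = 0"
proof -
  have "Poly_Mapping.lookup (Poly_Mapping.single m c * f) k = (\<Sum>l::'a. 0)"
    unfolding lookup_mult
    by (intro arg_cong[of _ _ Sum_any] ext) (auto simp: lookup_single when_def assms)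
  then show ?thesis by simp
qed

lemma lookup_const3_times [simp]: "lookup3 (const3 c * f) n = c * lookup3 f n"
  using lookup_single_times[of 0 c f n] by (simp add: const3_def)

lemma lookup_xv_times [simp]:
  "lookup3 (xv * f) (a, b, c) = (if a = 0 then 0 else lookup3 f (a - 1, b, c))"
  using lookup_single_times[of "(1, 0, 0)" 1 f "(a - 1, b, c)"]
  by (auto simp: xv_def intro!: lookup_single_times_eq_0)

lemma lookup_yv_times [simp]:
  "lookup3 (yv * f) (a, b, c) = (if b = 0 then 0 else lookup3 f (a, b - 1, c))"
  using lookup_single_times[of "(0, 1, 0)" 1 f "(a, b - 1, c)"]
  by (auto simp: yv_def intro!: lookup_single_times_eq_0)

lemma lookup_zv_times [simp]:
  "lookup3 (zv * f) (a, b, c) = (if c = 0 then 0 else lookup3 f (a, b, c - 1))"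
  using lookup_single_times[of "(0, 0, 1)" 1 f "(a, b, c - 1)"]
  by (auto simp: zv_def intro!: lookup_single_times_eq_0)

lemma const3_simps [simp]: "const3 0 = 0" "const3 1 = 1" "const3 (- c) = - const3 c"
  by (simp_all add: const3_def single_uminus)

lemma const3_add: "const3 (c + d) = const3 c + const3 d"
  by (simp add: const3_def single_add)

lemma const3_mult: "const3 (c * d) = const3 c * const3 d"
  by (simp add: const3_def mult_single)

lemma single_eq_monomial:
  "Poly_Mapping.single (a, b, c) v = const3 v * xv ^ a * yv ^ b * zv ^ c"
proof -
  have x: "xv ^ a = Poly_Mapping.single (a, 0, 0) 1"
    by (induction a) (auto simp: xv_def mult_single simp flip: single_one zero_prod_def)
  have y: "yv ^ b = Poly_Mapping.single (0, b, 0) 1"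
    by (induction b) (auto simp: yv_def mult_single simp flip: single_one zero_prod_def)
  have z: "zv ^ c = Poly_Mapping.single (0, 0, c) 1"
    by (induction c) (auto simp: zv_def mult_single simp flip: single_one zero_prod_def)
  show ?thesis
    unfolding x y z const3_def by (simp add: mult_single zero_prod_def)
qed

lemma poly3_eq_sum_monomials: "f = (\<Sum>m\<in>Poly_Mapping.keys f. Poly_Mapping.single m (lookup3 f m))"
proof (rule poly_mapping_eqI)
  fix n
  have "(\<Sum>m\<in>Poly_Mapping.keys f. lookup3 f m when m = n) = lookup3 f n"
    by (cases "n \<in> Poly_Mapping.keys f")
      (auto simp: when_def sum.delta' in_keys_iff intro!: sum.neutral)
  then show "lookup3 f n = lookup3 (\<Sum>m\<in>Poly_Mapping.keys f. Poly_Mapping.single m (lookup3 f m)) n"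
    by (simp add: lookup_sum lookup_single)
qed

lemma poly3_monomial_induct [case_names monomial add]:
  assumes m: "\<And>a b c v. P (const3 v * xv ^ a * yv ^ b * zv ^ c)"
    and a: "\<And>f g. P f \<Longrightarrow> P g \<Longrightarrow> P (f + g)"
  shows "P (f :: poly3)"
proof -
  have "P 0" using m[of 0] by simp
  have "P (\<Sum>m\<in>A. Poly_Mapping.single m (lookup3 f m))" if "finite A" for A
    using that by induction (auto intro!: a m \<open>P 0\<close> simp: single_eq_monomial)
  from this[of "Poly_Mapping.keys f"] show ?thesis
    by (subst poly3_eq_sum_monomials) simp
qed

text \<open>The three variables generate R over the constants. Used to extend closure under the
  variables to closure under all of R.\<close>

lemma poly3_induct [case_names const add x y z]:
  assumes c: "\<And>v. P (const3 v)"
    and a: "\<And>f g. P f \<Longrightarrow> P g \<Longrightarrow> P (f + g)"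
    and x: "\<And>f. P f \<Longrightarrow> P (xv * f)"
    and y: "\<And>f. P f \<Longrightarrow> P (yv * f)"
    and z: "\<And>f. P f \<Longrightarrow> P (zv * f)"
  shows "P (f :: poly3)"
proof (induction f rule: poly3_monomial_induct)
  case (monomial a b c v)
  have "P (xv ^ a * (yv ^ b * (zv ^ c * const3 v)))"
  proof (induction a)
    case 0
    show ?case
    proof (induction b)
      case 0
      show ?case by (induction c) (auto simp: mult.assoc intro: c z)
    qed (auto simp: mult.assoc intro: y)
  qed (auto simp: mult.assoc intro: x)
  then show ?case by (simp add: ac_simps)
qed (rule a)

section \<open>Evaluation at the points (a, 0, 0) of the x-axis\<close>

definition eval_axis :: "complex \<Rightarrow> poly3 \<Rightarrow> complex" where
  "eval_axis a f = (\<Sum>(i, j, k)\<in>Poly_Mapping.keys f. if j = 0 \<and> k = 0 then lookup3 f (i, j, k) * a ^ i else 0)"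

text \<open>The supports of f, g and f + g differ; over a common finite index set their values can
  be compared term by term.\<close>

lemma eval_axis_superset:
  assumes "finite A" "Poly_Mapping.keys f \<subseteq> A"
  shows "eval_axis a f = (\<Sum>(i, j, k)\<in>A. if j = 0 \<and> k = 0 then lookup3 f (i, j, k) * a ^ i else 0)"
  unfolding eval_axis_def using assms
  by (intro sum.mono_neutral_left) (auto simp: in_keys_iff)

lemma eval_axis_add [simp]: "eval_axis a (f + g) = eval_axis a f + eval_axis a g"
proof -
  let ?A = "Poly_Mapping.keys f \<union> Poly_Mapping.keys g"
  have e: "eval_axis a h = (\<Sum>(i, j, k)\<in>?A. if j = 0 \<and> k = 0 then lookup3 h (i, j, k) * a ^ i else 0)"
    if "Poly_Mapping.keys h \<subseteq> ?A" for h
    using that by (intro eval_axis_superset) auto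
  have "eval_axis a (f + g) = (\<Sum>m\<in>?A. (case m of (i, j, k) \<Rightarrow> if j = 0 \<and> k = 0 then lookup3 f (i, j, k) * a ^ i else 0)
      + (case m of (i, j, k) \<Rightarrow> if j = 0 \<and> k = 0 then lookup3 g (i, j, k) * a ^ i else 0))"
    unfolding e[OF keys_add] by (rule sum.cong) (auto simp: lookup_add distrib_right)
  also have "\<dots> = eval_axis a f + eval_axis a g"
    unfolding sum.distrib by (simp add: e)
  finally show ?thesis .
qed

lemma eval_axis_single [simp]:
  "eval_axis a (Poly_Mapping.single (i, j, k) c) = (if j = 0 \<and> k = 0 then c * a ^ i else 0)"
  by (subst eval_axis_superset[of "{(i, j, k)}"]) auto

lemma eval_axis_mult [simp]: "eval_axis a (f * g) = eval_axis a f * eval_axis a g"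
proof (induction f rule: poly3_monomial_induct)
  case (monomial i j k v)
  show ?case
  proof (induction g rule: poly3_monomial_induct)
    case (monomial i' j' k' v')
    show ?case
      unfolding single_eq_monomial[symmetric] by (simp add: mult_single power_add)
  qed (simp add: distrib_left)
qed (simp add: distrib_right)

lemma eval_axis_const3 [simp]: "eval_axis a (const3 c) = c"
  by (simp add: const3_def zero_prod_def)

lemma eval_axis_0 [simp]: "eval_axis a 0 = 0"
  and eval_axis_1 [simp]: "eval_axis a 1 = 1"
  using eval_axis_const3[of a 0] eval_axis_const3[of a 1] by simp_all

lemma eval_axis_diff [simp]: "eval_axis a (f - g) = eval_axis a f - eval_axis a g"
  using eval_axis_add[of a "f - g" g] by simp

lemma eval_axis_vars [simp]: "eval_axis a xv = a" "eval_axis a yv = 0" "eval_axis a zv = 0"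
  by (simp_all add: xv_def yv_def zv_def)

text \<open>The kernel of evaluation at (a, 0, 0) is the maximal ideal (x - a, y, z). The cofactors
  later serve as coefficients with respect to generators when a point is added.\<close>

lemma eval_axis_decompose:
  "\<exists>s t u. f - const3 (eval_axis a f) = s * (xv - const3 a) + t * yv + u * zv"
proof (induction f rule: poly3_induct)
  case (const v)
  show ?case by (intro exI[of _ 0]) simp
next
  case (add f g)
  from add.IH(1) obtain s t u where
    f: "f - const3 (eval_axis a f) = s * (xv - const3 a) + t * yv + u * zv" by (elim exE)
  from add.IH(2) obtain s' t' u' where
    g: "g - const3 (eval_axis a g) = s' * (xv - const3 a) + t' * yv + u' * zv" by (elim exE)
  have "f + g - const3 (eval_axis a (f + g)) = (f - const3 (eval_axis a f)) + (g - const3 (eval_axis a g))"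
    by (simp add: const3_add)
  also have "\<dots> = (s + s') * (xv - const3 a) + (t + t') * yv + (u + u') * zv"
    unfolding f g by (simp only: distrib_right add_ac)
  finally show ?case by (intro exI)
next
  case (x f)
  from x.IH obtain s t u where
    f: "f - const3 (eval_axis a f) = s * (xv - const3 a) + t * yv + u * zv" by (elim exE)
  \<comment> \<open>With c the value of f at the point: x f - a c = (x - a) f + a (f - c).\<close>
  have "xv * f - const3 (eval_axis a (xv * f)) = f * (xv - const3 a) + const3 a * (f - const3 (eval_axis a f))"
    unfolding eval_axis_mult eval_axis_vars const3_mult
    by (simp only: right_diff_distrib mult.commute add_diff_eq diff_add_cancel)
  also have "\<dots> = (f + const3 a * s) * (xv - const3 a) + (const3 a * t) * yv + (const3 a * u) * zv"
    unfolding f by (simp only: distrib_right distrib_left add_ac mult_ac)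
  finally show ?case by (intro exI)
next
  case (y f)
  show ?case by (rule exI[of _ 0], rule exI[of _ f], rule exI[of _ 0]) (simp add: mult.commute)
next
  case (z f)
  show ?case by (rule exI[of _ 0], rule exI[of _ 0], rule exI[of _ f]) (simp add: mult.commute)
qed

section \<open>Partial derivatives, given on coefficients\<close>

definition dx :: "poly3 \<Rightarrow> poly3" where
  "dx f = Abs_poly_mapping (\<lambda>(a, b, c). of_nat (a + 1) * lookup3 f (a + 1, b, c))"
definition dy :: "poly3 \<Rightarrow> poly3" where
  "dy f = Abs_poly_mapping (\<lambda>(a, b, c). of_nat (b + 1) * lookup3 f (a, b + 1, c))"
definition dz :: "poly3 \<Rightarrow> poly3" where
  "dz f = Abs_poly_mapping (\<lambda>(a, b, c). of_nat (c + 1) * lookup3 f (a, b, c + 1))"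

lemma lookup_dx [simp]: "lookup3 (dx f) (a, b, c) = of_nat (a + 1) * lookup3 f (a + 1, b, c)"
proof -
  \<comment> \<open>The exponent shift is injective, so the support stays finite, as
    \<open>Abs_poly_mapping\<close> requires.\<close>
  have "finite ((\<lambda>(a, b, c). (a + 1, b, c)) -` Poly_Mapping.keys f)"
    by (rule finite_vimageI) (auto intro: injI)
  then have "finite {m. (\<lambda>(a, b, c). of_nat (a + 1) * lookup3 f (a + 1, b, c)) m \<noteq> 0}"
    by (rule rev_finite_subset) (auto simp: in_keys_iff)
  then show ?thesis by (simp add: dx_def)
qed

lemma lookup_dy [simp]: "lookup3 (dy f) (a, b, c) = of_nat (b + 1) * lookup3 f (a, b + 1, c)"
proof -
  have "finite ((\<lambda>(a, b, c). (a, b + 1, c)) -` Poly_Mapping.keys f)"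
    by (rule finite_vimageI) (auto intro: injI)
  then have "finite {m. (\<lambda>(a, b, c). of_nat (b + 1) * lookup3 f (a, b + 1, c)) m \<noteq> 0}"
    by (rule rev_finite_subset) (auto simp: in_keys_iff)
  then show ?thesis by (simp add: dy_def)
qed

lemma lookup_dz [simp]: "lookup3 (dz f) (a, b, c) = of_nat (c + 1) * lookup3 f (a, b, c + 1)"
proof -
  have "finite ((\<lambda>(a, b, c). (a, b, c + 1)) -` Poly_Mapping.keys f)"
    by (rule finite_vimageI) (auto intro: injI)
  then have "finite {m. (\<lambda>(a, b, c). of_nat (c + 1) * lookup3 f (a, b, c + 1)) m \<noteq> 0}"
    by (rule rev_finite_subset) (auto simp: in_keys_iff)
  then show ?thesis by (simp add: dz_def)
qed

lemma poly3_eqI: "(\<And>a b c. lookup3 f (a, b, c) = lookup3 g (a, b, c)) \<Longrightarrow> f = g"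
  by (rule poly_mapping_eqI) auto

lemma dx_simps:
  "dx 0 = 0" "dx (f + g) = dx f + dx g" "dx (f - g) = dx f - dx g"
  "dx (const3 c * f) = const3 c * dx f"
  "dx (xv * f) = f + xv * dx f" "dx (yv * f) = yv * dx f" "dx (zv * f) = zv * dx f"
  by (rule poly3_eqI; auto simp: lookup_add lookup_minus distrib_left distrib_right right_diff_distrib mult.left_commute)+

lemma dy_simps:
  "dy 0 = 0" "dy (f + g) = dy f + dy g" "dy (f - g) = dy f - dy g"
  "dy (const3 c * f) = const3 c * dy f"
  "dy (xv * f) = xv * dy f" "dy (yv * f) = f + yv * dy f" "dy (zv * f) = zv * dy f"
  by (rule poly3_eqI; auto simp: lookup_add lookup_minus distrib_left distrib_right right_diff_distrib mult.left_commute)+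

lemma dz_simps:
  "dz 0 = 0" "dz (f + g) = dz f + dz g" "dz (f - g) = dz f - dz g"
  "dz (const3 c * f) = const3 c * dz f"
  "dz (xv * f) = xv * dz f" "dz (yv * f) = yv * dz f" "dz (zv * f) = f + zv * dz f"
  by (rule poly3_eqI; auto simp: lookup_add lookup_minus distrib_left distrib_right right_diff_distrib mult.left_commute)+

section \<open>Dimension of quotients via coordinates\<close>

text \<open>An isomorphism of V/N with the functions on I, given on representatives; the dual
  elements in the last clause express surjectivity. The index type is arbitrary so that disjoint
  unions can be used where dimensions add up.\<close>

definition quot_coords ::
    "(complex \<Rightarrow> 'a::ab_group_add \<Rightarrow> 'a) \<Rightarrow> 'a set \<Rightarrow> 'a set \<Rightarrow> 'i set \<Rightarrow> ('a \<Rightarrow> 'i \<Rightarrow> complex) \<Rightarrow> bool" where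
  "quot_coords sm V N I T \<longleftrightarrow>
     (\<forall>u\<in>V. \<forall>v\<in>V. \<forall>i\<in>I. T (u + v) i = T u i + T v i) \<and>
     (\<forall>c. \<forall>v\<in>V. \<forall>i\<in>I. T (sm c v) i = c * T v i) \<and>
     (\<forall>v\<in>V. v \<in> N \<longleftrightarrow> (\<forall>i\<in>I. T v i = 0)) \<and>
     (\<forall>i\<in>I. \<exists>b\<in>V. \<forall>j\<in>I. T b j = (if j = i then 1 else 0))"

text \<open>The elements dual to the coordinates form a basis modulo N.\<close>

lemma quot_dim_if_coords:
  assumes "vector_space sm" and V: "module.subspace sm V" and fin: "finite I"
    and T: "quot_coords sm V N I T"
  shows "quot_dim sm V N (card I)"
proof -
  interpret vector_space sm by fact
  from T have add: "\<And>u v i. u \<in> V \<Longrightarrow> v \<in> V \<Longrightarrow> i \<in> I \<Longrightarrow> T (u + v) i = T u i + T v i"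
    and scale: "\<And>c v i. v \<in> V \<Longrightarrow> i \<in> I \<Longrightarrow> T (sm c v) i = c * T v i"
    and ker: "\<And>v. v \<in> V \<Longrightarrow> v \<in> N \<longleftrightarrow> (\<forall>i\<in>I. T v i = 0)"
    and dual: "\<forall>i\<in>I. \<exists>b. b \<in> V \<and> (\<forall>j\<in>I. T b j = (if j = i then 1 else 0))"
    unfolding quot_coords_def by blast+
  obtain e where e: "bij_betw e {..<card I} I"
    using ex_bij_betw_nat_finite[OF fin] by (auto simp: atLeast0LessThan)
  obtain b where b: "\<And>i. i \<in> I \<Longrightarrow> b i \<in> V" and bT: "\<And>i j. i \<in> I \<Longrightarrow> j \<in> I \<Longrightarrow> T (b i) j = (if j = i then 1 else 0)"
    using bchoice[OF dual] by blast
  have eI: "e i \<in> I" if "i < card I" for i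
    using e that by (auto simp: bij_betw_def)
  have inV: "(\<Sum>i\<in>A. sm (c i) (b (e i))) \<in> V" if "A \<subseteq> {..<card I}" for c A
    using that eI b by (intro subspace_sum V subspace_scale) auto
  have T0: "T 0 i = 0" if "i \<in> I" for i
    using scale[OF subspace_0[OF V] that, of 0] by simp
  have Tsum: "T (\<Sum>i<card I. sm (c i) (b (e i))) (e j) = c j" if j: "j < card I" for c j
  proof -
    \<comment> \<open>T is additive on V only, so the induction runs over partial sums, all of which
      stay in V.\<close>
    have "T (\<Sum>i\<in>A. sm (c i) (b (e i))) (e j) = (\<Sum>i\<in>A. c i * T (b (e i)) (e j))"
      if "finite A" "A \<subseteq> {..<card I}" for A
      using that
    proof (induction A)
      case (insert a A)
      then show ?case
        using inV[of A c] eI b j by (auto simp: add scale subspace_scale[OF V])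
    qed (simp add: T0 eI j)
    from this[of "{..<card I}"] have "T (\<Sum>i<card I. sm (c i) (b (e i))) (e j)
        = (\<Sum>i<card I. c i * (if e j = e i then 1 else 0))"
      using eI j by (simp add: bT)
    also have "\<dots> = (\<Sum>i<card I. if i = j then c i else 0)"
      using e j by (intro sum.cong) (auto simp: bij_betw_def inj_on_def)
    finally show ?thesis using j by simp
  qed
  show ?thesis
    unfolding quot_dim_def
  proof (intro exI[of _ "\<lambda>i. b (e i)"] conjI allI impI ballI)
    fix i c
    assume "(\<Sum>i<card I. sm (c i) (b (e i))) \<in> N" "i < card I"
    then show "c i = 0"
      using ker[OF inV[of "{..<card I}" c]] Tsum[of i c] eI[of i] by auto
  next
    fix v
    assume v: "v \<in> V"
    let ?s = "\<Sum>i<card I. sm (T v (e i)) (b (e i))"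
    have diff: "v - ?s \<in> V" using v inV[of "{..<card I}" "\<lambda>i. T v (e i)"] by (intro subspace_diff V) auto
    have "T (v - ?s) i = 0" if i: "i \<in> I" for i
    proof -
      obtain j where j: "j < card I" "i = e j" using e i by (auto simp: bij_betw_def)
      have "T v i = T (v - ?s) i + T ?s i"
        using add[OF diff inV[of "{..<card I}" "\<lambda>i. T v (e i)"] i] by simp
      then show ?thesis using Tsum[OF j(1), of "\<lambda>i. T v (e i)"] j by simp
    qed
    then show "\<exists>c. v - (\<Sum>i<card I. sm (c i) (b (e i))) \<in> N"
      using ker[OF diff] by (intro exI[of _ "\<lambda>i. T v (e i)"]) blast
  qed (use b eI in auto)
qed

text \<open>Independence modulo N makes the coefficients of each v unique; hence coefficients picked
  by choice depend linearly on v.\<close>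

lemma quot_coords_if_dim:
  assumes "vector_space sm" and V: "module.subspace sm V" and N: "module.subspace sm N"
    and NV: "N \<subseteq> V" and dim: "quot_dim sm V N n"
  shows "\<exists>T. quot_coords sm V N {..<n} T"
proof -
  interpret vector_space sm by fact
  from dim obtain b where b: "\<And>i. i < n \<Longrightarrow> b i \<in> V"
    and ind: "\<And>c. (\<Sum>i<n. sm (c i) (b i)) \<in> N \<Longrightarrow> \<forall>i<n. c i = 0"
    and span: "\<forall>v\<in>V. \<exists>c. v - (\<Sum>i<n. sm (c i) (b i)) \<in> N"
    unfolding quot_dim_def by blast
  obtain T where T: "\<And>v. v \<in> V \<Longrightarrow> v - (\<Sum>i<n. sm (T v i) (b i)) \<in> N"
    using bchoice[OF span] by blast
  have uniq: "T v i = c i" if v: "v \<in> V" "v - (\<Sum>i<n. sm (c i) (b i)) \<in> N" and i: "i < n" for v c i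
  proof -
    have "(\<Sum>i<n. sm (T v i - c i) (b i)) = (v - (\<Sum>i<n. sm (c i) (b i))) - (v - (\<Sum>i<n. sm (T v i) (b i)))"
      by (simp add: scale_left_diff_distrib sum_subtractf)
    then have "(\<Sum>i<n. sm (T v i - c i) (b i)) \<in> N"
      using subspace_diff[OF N v(2) T[OF v(1)]] by simp
    from ind[OF this] i show ?thesis by simp
  qed
  have "quot_coords sm V N {..<n} T"
    unfolding quot_coords_def
  proof (intro conjI ballI allI)
    fix u v i assume uv: "u \<in> V" "v \<in> V" and i: "i \<in> {..<n}"
    have "u + v - (\<Sum>i<n. sm (T u i + T v i) (b i))
        = (u - (\<Sum>i<n. sm (T u i) (b i))) + (v - (\<Sum>i<n. sm (T v i) (b i)))"
      by (simp add: scale_left_distrib sum.distrib)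
    then have "u + v - (\<Sum>i<n. sm (T u i + T v i) (b i)) \<in> N"
      using subspace_add[OF N T[OF uv(1)] T[OF uv(2)]] by (simp only:)
    then show "T (u + v) i = T u i + T v i"
      using uv i by (intro uniq subspace_add[OF V]) auto
  next
    fix c v i assume v: "v \<in> V" and i: "i \<in> {..<n}"
    have "sm c v - (\<Sum>i<n. sm (c * T v i) (b i)) = sm c (v - (\<Sum>i<n. sm (T v i) (b i)))"
      by (simp add: scale_right_diff_distrib scale_sum_right)
    then show "T (sm c v) i = c * T v i"
      using v i subspace_scale[OF N T[OF v]] by (intro uniq subspace_scale[OF V]) auto
  next
    fix v assume v: "v \<in> V"
    show "v \<in> N \<longleftrightarrow> (\<forall>i\<in>{..<n}. T v i = 0)"
    proof
      assume "v \<in> N" then show "\<forall>i\<in>{..<n}. T v i = 0"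
        using uniq[OF v, of "\<lambda>_. 0"] by simp
    next
      assume "\<forall>i\<in>{..<n}. T v i = 0" then show "v \<in> N"
        using T[OF v] by simp
    qed
  next
    fix i assume i: "i \<in> {..<n}"
    have "(\<Sum>j<n. sm (if j = i then 1 else 0) (b j)) = (\<Sum>j<n. if j = i then b j else 0)"
      by (intro sum.cong) auto
    then have "b i - (\<Sum>j<n. sm (if j = i then 1 else 0) (b j)) \<in> N"
      using i subspace_0[OF N] by simp
    then show "\<exists>b\<in>V. \<forall>j\<in>{..<n}. T b j = (if j = i then 1 else 0)"
      using b i by (intro bexI[of _ "b i"] ballI uniq) auto
  qed
  then show ?thesis by blast
qed

section \<open>Submodules and homomorphisms into the quotient\<close>

lemma rmult_simps:
  "rmult f (u + v) = rmult f u + rmult f v" "rmult (f + g) v = rmult f v + rmult g v"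
  "rmult f (u - v) = rmult f u - rmult f v" "rmult (f - g) v = rmult f v - rmult g v"
  "rmult (f * g) v = rmult f (rmult g v)" "rmult 1 v = v" "rmult 0 v = 0" "rmult f 0 = 0"
  by (auto simp: rmult_def fun_eq_iff algebra_simps)

lemma rmult_left_commute: "rmult f (rmult g v) = rmult g (rmult f v)"
  by (simp add: rmult_def fun_eq_iff mult.left_commute)

lemma vector_space_vsmult: "vector_space vsmult"
  by unfold_locales
    (simp_all add: vsmult_def rmult_def fun_eq_iff const3_add const3_mult algebra_simps)

lemma vector_space_hsmult: "vector_space hsmult"
proof -
  interpret vector_space vsmult by (rule vector_space_vsmult)
  show ?thesis
    by unfold_locales (simp_all add: hsmult_def fun_eq_iff scale_right_distrib scale_left_distrib)
qed

lemma submodule_subset: "is_submodule r K \<Longrightarrow> K \<subseteq> free_module r"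
  and submodule_0: "is_submodule r K \<Longrightarrow> 0 \<in> K"
  and submodule_add: "is_submodule r K \<Longrightarrow> u \<in> K \<Longrightarrow> v \<in> K \<Longrightarrow> u + v \<in> K"
  and submodule_rmult: "is_submodule r K \<Longrightarrow> u \<in> K \<Longrightarrow> rmult f u \<in> K"
  by (auto simp: is_submodule_def)

lemma submodule_uminus: "is_submodule r K \<Longrightarrow> u \<in> K \<Longrightarrow> - u \<in> K"
  using submodule_rmult[of r K u "-1"] by (simp add: rmult_def fun_Compl_def)

lemma submodule_diff: "is_submodule r K \<Longrightarrow> u \<in> K \<Longrightarrow> v \<in> K \<Longrightarrow> u - v \<in> K"
  using submodule_add[of r K u "- v"] submodule_uminus[of r K v] by simp

lemma submodule_vsmult: "is_submodule r K \<Longrightarrow> u \<in> K \<Longrightarrow> vsmult c u \<in> K"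
  by (simp add: vsmult_def submodule_rmult)

lemma submodule_diff_iff:
  assumes "is_submodule r K" and "u - v \<in> K"
  shows "u \<in> K \<longleftrightarrow> v \<in> K"
  using submodule_add[OF assms(1,2), of v] submodule_diff[OF assms(1) _ assms(2), of u] by auto

lemma submodule_free: "is_submodule r (free_module r)"
  by (auto simp: is_submodule_def free_module_def rmult_def)

lemma subspace_submodule: "is_submodule r K \<Longrightarrow> module.subspace vsmult K"
proof -
  assume K: "is_submodule r K"
  interpret vector_space vsmult by (rule vector_space_vsmult)
  show ?thesis
    using K by (auto simp: subspace_def submodule_0 submodule_add submodule_vsmult)
qed

lemma hom_lifts_free: "\<phi> \<in> hom_lifts r K \<Longrightarrow> \<phi> k \<in> free_module r"
  by (cases "k \<in> K") (auto simp: hom_lifts_def free_module_def)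

lemma hom_lifts_outside: "\<phi> \<in> hom_lifts r K \<Longrightarrow> k \<notin> K \<Longrightarrow> \<phi> k = 0"
  and hom_lifts_add: "\<phi> \<in> hom_lifts r K \<Longrightarrow> k \<in> K \<Longrightarrow> l \<in> K \<Longrightarrow> \<phi> (k + l) - \<phi> k - \<phi> l \<in> K"
  and hom_lifts_rmult: "\<phi> \<in> hom_lifts r K \<Longrightarrow> k \<in> K \<Longrightarrow> \<phi> (rmult f k) - rmult f (\<phi> k) \<in> K"
  by (auto simp: hom_lifts_def)

lemma subspace_hom_lifts:
  assumes K: "is_submodule r K"
  shows "module.subspace hsmult (hom_lifts r K)"
proof -
  interpret vector_space hsmult by (rule vector_space_hsmult)
  interpret V: vector_space vsmult by (rule vector_space_vsmult)
  have F: "is_submodule r (free_module r)" by (rule submodule_free)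
  show ?thesis
    unfolding subspace_def
  proof (intro conjI ballI allI)
    show "0 \<in> hom_lifts r K"
      using submodule_0[OF K] submodule_0[OF F] by (simp add: hom_lifts_def rmult_simps)
  next
    fix \<phi> \<psi> assume h: "\<phi> \<in> hom_lifts r K" "\<psi> \<in> hom_lifts r K"
    have "(\<phi> + \<psi>) (k + l) - (\<phi> + \<psi>) k - (\<phi> + \<psi>) l \<in> K" if "k \<in> K" "l \<in> K" for k l
      using submodule_add[OF K hom_lifts_add[OF h(1) that] hom_lifts_add[OF h(2) that]]
      by (simp add: algebra_simps)
    moreover have "(\<phi> + \<psi>) (rmult f k) - rmult f ((\<phi> + \<psi>) k) \<in> K" if "k \<in> K" for f k
      using submodule_add[OF K hom_lifts_rmult[OF h(1) that] hom_lifts_rmult[OF h(2) that]]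
      by (simp add: rmult_simps algebra_simps)
    ultimately show "\<phi> + \<psi> \<in> hom_lifts r K"
      using h by (auto simp: hom_lifts_def intro: submodule_add[OF F])
  next
    fix c \<phi> assume h: "\<phi> \<in> hom_lifts r K"
    have "hsmult c \<phi> (k + l) - hsmult c \<phi> k - hsmult c \<phi> l \<in> K" if "k \<in> K" "l \<in> K" for k l
      using submodule_vsmult[OF K hom_lifts_add[OF h that], of c]
      by (simp add: hsmult_def V.scale_right_diff_distrib)
    moreover have "hsmult c \<phi> (rmult f k) - rmult f (hsmult c \<phi> k) \<in> K" if "k \<in> K" for f k
      using submodule_vsmult[OF K hom_lifts_rmult[OF h that], of c]
      by (simp add: hsmult_def V.scale_right_diff_distrib) (simp add: vsmult_def rmult_left_commute)
    ultimately show "hsmult c \<phi> \<in> hom_lifts r K"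
      using h by (auto simp: hom_lifts_def hsmult_def intro: submodule_vsmult[OF F])
  qed
qed

lemma subspace_hom_null:
  assumes K: "is_submodule r K"
  shows "module.subspace hsmult (hom_null r K)"
proof -
  interpret vector_space hsmult by (rule vector_space_hsmult)
  show ?thesis
    using subspace_hom_lifts[OF K] submodule_0[OF K] submodule_add[OF K] submodule_vsmult[OF K]
    unfolding subspace_def hom_null_def by (auto simp: hsmult_def)
qed

text \<open>\<open>hom_lifts\<close> asks for the value 0 outside K; truncation turns a formula that
  makes sense everywhere into a lift.\<close>

definition hom_on :: "vec3 set \<Rightarrow> (vec3 \<Rightarrow> vec3) \<Rightarrow> vec3 \<Rightarrow> vec3" where
  "hom_on K L = (\<lambda>k. if k \<in> K then L k else 0)"

lemma hom_on_apply [simp]: "k \<in> K \<Longrightarrow> hom_on K L k = L k"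
  by (simp add: hom_on_def)

lemma hom_on_in_hom_lifts:
  assumes K: "is_submodule r K"
    and free: "\<And>k. k \<in> K \<Longrightarrow> L k \<in> free_module r"
    and add: "\<And>k l. k \<in> K \<Longrightarrow> l \<in> K \<Longrightarrow> L (k + l) - L k - L l \<in> K"
    and rmult: "\<And>f k. k \<in> K \<Longrightarrow> L (rmult f k) - rmult f (L k) \<in> K"
  shows "hom_on K L \<in> hom_lifts r K"
  using assms submodule_add[OF K] submodule_rmult[OF K] by (simp add: hom_lifts_def hom_on_def)

lemma linear_hom_on_in_hom_lifts:
  assumes K: "is_submodule r K"
    and free: "\<And>k. k \<in> K \<Longrightarrow> L k \<in> free_module r"
    and add: "\<And>k l. L (k + l) = L k + L l"
    and scale: "\<And>c k. L (rmult (const3 c) k) = rmult (const3 c) (L k)"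
    and x: "\<And>k. k \<in> K \<Longrightarrow> L (rmult xv k) - rmult xv (L k) \<in> K"
    and y: "\<And>k. k \<in> K \<Longrightarrow> L (rmult yv k) - rmult yv (L k) \<in> K"
    and z: "\<And>k. k \<in> K \<Longrightarrow> L (rmult zv k) - rmult zv (L k) \<in> K"
  shows "hom_on K L \<in> hom_lifts r K"
proof (rule hom_on_in_hom_lifts[OF K free])
  \<comment> \<open>The defect of L at v f is its defect at v, taken at f k, plus v times its defect
    at f.\<close>
  have var: "L (rmult (v * f) k) - rmult (v * f) (L k) \<in> K"
    if "L (rmult v (rmult f k)) - rmult v (L (rmult f k)) \<in> K" "L (rmult f k) - rmult f (L k) \<in> K" for v f k
    using submodule_add[OF K that(1) submodule_rmult[OF K that(2), of v]]
    by (simp add: rmult_simps)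
  fix f k assume k: "k \<in> K"
  show "L (rmult f k) - rmult f (L k) \<in> K"
  proof (rule poly3_induct[of "\<lambda>f. L (rmult f k) - rmult f (L k) \<in> K"])
    show "L (rmult (const3 c) k) - rmult (const3 c) (L k) \<in> K" for c
      using submodule_0[OF K] by (simp add: scale)
  next
    fix g h
    assume "L (rmult g k) - rmult g (L k) \<in> K" "L (rmult h k) - rmult h (L k) \<in> K"
    from submodule_add[OF K this] show "L (rmult (g + h) k) - rmult (g + h) (L k) \<in> K"
      by (simp add: rmult_simps add algebra_simps)
  qed (use k submodule_rmult[OF K] in \<open>auto intro!: var x y z\<close>)
next
  fix k l :: vec3
  have "L (k + l) - L k - L l = 0" by (simp add: add)
  then show "L (k + l) - L k - L l \<in> K" using submodule_0[OF K] by (simp only:)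
qed

lemma quot_coordsD:
  assumes "quot_coords sm V N I T"
  shows "u \<in> V \<Longrightarrow> v \<in> V \<Longrightarrow> i \<in> I \<Longrightarrow> T (u + v) i = T u i + T v i"
    and "v \<in> V \<Longrightarrow> i \<in> I \<Longrightarrow> T (sm c v) i = c * T v i"
    and "v \<in> V \<Longrightarrow> v \<in> N \<longleftrightarrow> (\<forall>i\<in>I. T v i = 0)"
    and "i \<in> I \<Longrightarrow> \<exists>b\<in>V. \<forall>j\<in>I. T b j = (if j = i then 1 else 0)"
  using assms unfolding quot_coords_def by blast+

lemma quot_coords_cong:
  assumes "vector_space sm" "module.subspace sm V" and T: "quot_coords sm V N I T"
    and "u \<in> V" "v \<in> V" "u - v \<in> N" "i \<in> I"
  shows "T u i = T v i"
proof -
  interpret vector_space sm by fact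
  have "u - v \<in> V" using assms by (intro subspace_diff) auto
  then show ?thesis
    using quot_coordsD(1)[OF T, of "u - v" v i] quot_coordsD(3)[OF T, of "u - v"] assms by auto
qed

definition unit_vec :: "nat \<Rightarrow> vec3" where
  "unit_vec i = (\<lambda>j. if j = i then 1 else 0)"

text \<open>The condition on \<open>f\<close> says that all but finitely many points of the \<open>x\<close>-axis lie outside the
  support of the quotient module; this leaves room for further points.\<close>
definition quot_point :: "nat \<Rightarrow> nat \<Rightarrow> nat \<Rightarrow> vec3 set \<Rightarrow> bool" where
  "quot_point r d n K \<longleftrightarrow> is_submodule r K \<and> quot_dim vsmult (free_module r) K d \<and>
     quot_dim hsmult (hom_lifts r K) (hom_null r K) n \<and>
     (\<exists>f. (\<forall>v\<in>free_module r. rmult f v \<in> K) \<and> finite {a. eval_axis a f = 0})"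

lemma quot_point_coords:
  assumes "quot_point r d n K"
  obtains S T f where "is_submodule r K"
    "quot_coords vsmult (free_module r) K {..<d} S"
    "quot_coords hsmult (hom_lifts r K) (hom_null r K) {..<n} T"
    "\<And>v. v \<in> free_module r \<Longrightarrow> rmult f v \<in> K" "finite {a. eval_axis a f = 0}"
proof -
  have K: "is_submodule r K" using assms by (simp add: quot_point_def)
  have "\<exists>S. quot_coords vsmult (free_module r) K {..<d} S"
    using assms
    by (intro quot_coords_if_dim vector_space_vsmult subspace_submodule[OF submodule_free]
        subspace_submodule[OF K] submodule_subset[OF K]) (simp add: quot_point_def)
  moreover have "\<exists>T. quot_coords hsmult (hom_lifts r K) (hom_null r K) {..<n} T"
    using assms
    by (intro quot_coords_if_dim vector_space_hsmult subspace_hom_lifts[OF K]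
        subspace_hom_null[OF K]) (auto simp: quot_point_def hom_null_def)
  ultimately show ?thesis using that assms unfolding quot_point_def by blast
qed

lemma quot_point_if_coords:
  assumes K: "is_submodule r K" and "finite I" "finite J"
    and S: "quot_coords vsmult (free_module r) K I S"
    and T: "quot_coords hsmult (hom_lifts r K) (hom_null r K) J T"
    and "\<And>v. v \<in> free_module r \<Longrightarrow> rmult f v \<in> K" "finite {a. eval_axis a f = 0}"
  shows "quot_point r (card I) (card J) K"
  using assms unfolding quot_point_def
  by (auto intro: quot_dim_if_coords vector_space_vsmult vector_space_hsmult
      subspace_submodule[OF submodule_free] subspace_hom_lifts)

section \<open>Enlarging a point of the Quot scheme by a free summand or by a reduced point\<close>

lemma eval_axis_vsmult: "eval_axis a (vsmult c v i) = c * eval_axis a (v i)"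
  by (simp add: vsmult_def rmult_def)

lemma sum_closed:
  fixes g :: "'b \<Rightarrow> 'a::comm_monoid_add"
  assumes "finite A" "P 0" "\<And>u v. P u \<Longrightarrow> P v \<Longrightarrow> P (u + v)" "\<And>j. j \<in> A \<Longrightarrow> P (g j)"
  shows "P (sum g A)"
  using assms(1,4) by induction (auto intro: assms(2,3))

lemma hom_on_plus: "hom_on K (\<lambda>k. L k + M k) = hom_on K L + hom_on K M"
  by (simp add: hom_on_def fun_eq_iff)

lemma hom_on_hsmult: "hom_on K (\<lambda>k. vsmult c (L k)) = hsmult c (hom_on K L)"
  by (simp add: hom_on_def hsmult_def fun_eq_iff vsmult_def rmult_simps)

lemma hom_lifts_0:
  assumes "is_submodule r K" "\<phi> \<in> hom_lifts r K"
  shows "\<phi> 0 \<in> K"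
  using hom_lifts_rmult[OF assms(2) submodule_0[OF assms(1)], of 0] by (simp add: rmult_simps)

text \<open>Take for K' the direct sum of K and R e. The quotient is still M, and a homomorphism
  from K' to M is a pair: its restriction to K and its value at e. This gives n + d
  coordinates.\<close>

lemma quot_point_Suc_rank:
  assumes "quot_point r d n K"
  shows "\<exists>K'. quot_point (Suc r) d (n + d) K'"
proof -
  from assms obtain S T f where K: "is_submodule r K"
    and S: "quot_coords vsmult (free_module r) K {..<d} S"
    and T: "quot_coords hsmult (hom_lifts r K) (hom_null r K) {..<n} T"
    and f: "\<And>v. v \<in> free_module r \<Longrightarrow> rmult f v \<in> K" "finite {a. eval_axis a f = 0}"
    by (rule quot_point_coords) blast
  define tr :: "vec3 \<Rightarrow> vec3" where "tr v = v(r := 0)" for v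
  define K' where "K' = {v \<in> free_module (Suc r). tr v \<in> K}"
  define e where "e = unit_vec r"
  have tr_simps [simp]: "tr (u + v) = tr u + tr v" "tr (u - v) = tr u - tr v"
    "tr (rmult g v) = rmult g (tr v)" "tr (vsmult c v) = vsmult c (tr v)" "tr 0 = 0" for u v g c
    by (auto simp: tr_def rmult_def vsmult_def fun_eq_iff)
  have tr_free: "tr v \<in> free_module r" if "v \<in> free_module (Suc r)" for v
    using that by (auto simp: tr_def free_module_def Suc_le_eq)
  have tr_id: "tr v = v" if "v \<in> free_module r" for v
    using that by (auto simp: tr_def free_module_def fun_eq_iff)
  have free_sub: "v \<in> free_module (Suc r)" if "v \<in> free_module r" for v
    using that by (auto simp: free_module_def)
  have KK': "k \<in> K'" if "k \<in> K" for k
    using that submodule_subset[OF K] by (auto simp: K'_def tr_id free_sub)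
  note F = submodule_free[of "Suc r"]
  have K': "is_submodule (Suc r) K'"
    unfolding is_submodule_def
    using submodule_0[OF K] submodule_add[OF K] submodule_rmult[OF K]
      submodule_0[OF F] submodule_add[OF F] submodule_rmult[OF F]
    by (auto simp: K'_def)
  have e: "e \<in> K'" "tr e = 0"
    using submodule_0[OF K] by (auto simp: e_def unit_vec_def K'_def tr_def free_module_def zero_fun_def fun_upd_def if_distrib cong: if_cong)
  define \<rho> where "\<rho> \<phi> = hom_on K (\<lambda>k. tr (\<phi> k))" for \<phi> :: "vec3 \<Rightarrow> vec3"
  have \<rho>: "\<rho> \<phi> \<in> hom_lifts r K" if \<phi>: "\<phi> \<in> hom_lifts (Suc r) K'" for \<phi>
    unfolding \<rho>_def
  proof (rule hom_on_in_hom_lifts[OF K])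
    fix k l assume "k \<in> K" "l \<in> K"
    with hom_lifts_add[OF \<phi> KK' KK'] show "tr (\<phi> (k + l)) - tr (\<phi> k) - tr (\<phi> l) \<in> K"
      by (simp add: K'_def)
  next
    fix g k assume "k \<in> K"
    with hom_lifts_rmult[OF \<phi> KK'] show "tr (\<phi> (rmult g k)) - rmult g (tr (\<phi> k)) \<in> K"
      by (simp add: K'_def)
  qed (use hom_lifts_free[OF \<phi>] tr_free in auto)
  have S': "quot_coords vsmult (free_module (Suc r)) K' {..<d} (\<lambda>v. S (tr v))"
    unfolding quot_coords_def
  proof (intro conjI ballI allI)
    fix i assume "i \<in> {..<d}"
    from quot_coordsD(4)[OF S this] show "\<exists>b\<in>free_module (Suc r). \<forall>j\<in>{..<d}. S (tr b) j = (if j = i then 1 else 0)"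
      using free_sub tr_id by metis
  qed (use tr_free in \<open>auto simp: quot_coordsD(1,2)[OF S] K'_def quot_coordsD(3)[OF S]\<close>)
  let ?J = "Inl ` {..<n} \<union> Inr ` {..<d}"
  let ?T = "\<lambda>\<phi>. case_sum (T (\<rho> \<phi>)) (S (tr (\<phi> e)))"
  have T': "quot_coords hsmult (hom_lifts (Suc r) K') (hom_null (Suc r) K') ?J ?T"
    unfolding quot_coords_def
  proof (intro conjI ballI allI)
    fix \<phi> \<psi> i assume h: "\<phi> \<in> hom_lifts (Suc r) K'" "\<psi> \<in> hom_lifts (Suc r) K'" and i: "i \<in> ?J"
    have "\<rho> (\<phi> + \<psi>) = \<rho> \<phi> + \<rho> \<psi>" by (simp add: \<rho>_def hom_on_plus)
    then show "?T (\<phi> + \<psi>) i = ?T \<phi> i + ?T \<psi> i"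
      using i \<rho>[OF h(1)] \<rho>[OF h(2)] tr_free[OF hom_lifts_free[OF h(1)]] tr_free[OF hom_lifts_free[OF h(2)]]
      by (auto simp: quot_coordsD(1)[OF S] quot_coordsD(1)[OF T])
  next
    fix c \<phi> i assume h: "\<phi> \<in> hom_lifts (Suc r) K'" and i: "i \<in> ?J"
    have "\<rho> (hsmult c \<phi>) = hsmult c (\<rho> \<phi>)" by (simp add: \<rho>_def hsmult_def[of c \<phi>] hom_on_hsmult)
    then show "?T (hsmult c \<phi>) i = c * ?T \<phi> i"
      using i \<rho>[OF h] tr_free[OF hom_lifts_free[OF h]]
      by (auto simp: quot_coordsD(2)[OF S] quot_coordsD(2)[OF T] hsmult_def[of c \<phi>])
  next
    fix \<phi> assume h: "\<phi> \<in> hom_lifts (Suc r) K'"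
    have "\<phi> \<in> hom_null (Suc r) K' \<longleftrightarrow> \<rho> \<phi> \<in> hom_null r K \<and> tr (\<phi> e) \<in> K"
    proof
      assume "\<phi> \<in> hom_null (Suc r) K'"
      then show "\<rho> \<phi> \<in> hom_null r K \<and> tr (\<phi> e) \<in> K"
        using \<rho>[OF h] submodule_0[OF K] by (auto simp: hom_null_def \<rho>_def hom_on_def K'_def)
    next
      assume *: "\<rho> \<phi> \<in> hom_null r K \<and> tr (\<phi> e) \<in> K"
      have "\<phi> k \<in> K'" if k: "k \<in> K'" for k
      proof -
        have k1: "tr k \<in> K" using k by (simp add: K'_def)
        \<comment> \<open>The splitting of K' into K and the multiples of e; membership of the value
          in K' is then checked on both parts.\<close>
        have k2: "tr k + rmult (k r) e = k"
          by (auto simp: tr_def rmult_def e_def unit_vec_def fun_eq_iff)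
        have "tr (\<phi> (tr k)) \<in> K"
          using * k1 by (auto simp: hom_null_def \<rho>_def dest: spec[of _ "tr k"])
        then have p1: "\<phi> (tr k) \<in> K'" using hom_lifts_free[OF h] by (simp add: K'_def)
        have p2: "\<phi> e \<in> K'" using * hom_lifts_free[OF h] by (simp add: K'_def)
        have p3: "\<phi> (rmult (k r) e) \<in> K'"
          using submodule_diff_iff[OF K' hom_lifts_rmult[OF h e(1), of "k r"]] submodule_rmult[OF K' p2]
          by simp
        have "\<phi> k - \<phi> (tr k) - \<phi> (rmult (k r) e) \<in> K'"
          using hom_lifts_add[OF h KK'[OF k1] submodule_rmult[OF K' e(1), of "k r"]] by (simp add: k2)
        then show ?thesis
          using submodule_diff_iff[OF K'] p1 p3 by blast
      qed
      then show "\<phi> \<in> hom_null (Suc r) K'"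
        using h submodule_0[OF K'] hom_lifts_outside[OF h] by (auto simp: hom_null_def) metis
    qed
    then show "\<phi> \<in> hom_null (Suc r) K' \<longleftrightarrow> (\<forall>i\<in>?J. ?T \<phi> i = 0)"
      using \<rho>[OF h] tr_free[OF hom_lifts_free[OF h]]
      by (auto simp: quot_coordsD(3)[OF S] quot_coordsD(3)[OF T] ball_Un)
  next
    fix i assume "i \<in> ?J"
    then consider j where "i = Inl j" "j < n" | j where "i = Inr j" "j < d" by auto
    then show "\<exists>b\<in>hom_lifts (Suc r) K'. \<forall>j\<in>?J. ?T b j = (if j = i then 1 else 0)"
    proof cases
      case (1 j)
      then obtain \<psi> where \<psi>: "\<psi> \<in> hom_lifts r K" "\<forall>i<n. T \<psi> i = (if i = j then 1 else 0)"
        using quot_coordsD(4)[OF T, of j] by auto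
      \<comment> \<open>\<open>\<psi>\<close> extended by zero along e. Its value at e is
        \<open>\<psi> 0\<close>, which for a lift is only known to lie in K.\<close>
      let ?\<phi> = "hom_on K' (\<lambda>k. \<psi> (tr k))"
      have [simp]: "tr (\<psi> k) = \<psi> k" for k
        by (rule tr_id[OF hom_lifts_free[OF \<psi>(1)]])
      have "?\<phi> \<in> hom_lifts (Suc r) K'"
        using hom_lifts_free[OF \<psi>(1)] free_sub hom_lifts_add[OF \<psi>(1)] hom_lifts_rmult[OF \<psi>(1)] KK'
        by (intro hom_on_in_hom_lifts[OF K']) (auto simp: K'_def)
      moreover have "\<rho> ?\<phi> = \<psi>"
        using hom_lifts_outside[OF \<psi>(1)] submodule_subset[OF K] hom_lifts_free[OF \<psi>(1)]
        by (auto simp: \<rho>_def hom_on_def fun_eq_iff KK' tr_id subset_iff)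
      moreover have "S (tr (?\<phi> e)) i = 0" if "i < d" for i
      proof -
        have "tr (?\<phi> e) \<in> K"
          using hom_lifts_0[OF K \<psi>(1)] e tr_id[OF hom_lifts_free[OF \<psi>(1)]] by simp
        then show ?thesis
          using quot_coordsD(3)[OF S, of "tr (?\<phi> e)"] submodule_subset[OF K] that by blast
      qed
      ultimately show ?thesis
        using 1 \<psi>(2) by (intro bexI[of _ ?\<phi>]) (auto split: if_splits)
    next
      case (2 j)
      then obtain w where w: "w \<in> free_module r" "\<forall>i<d. S w i = (if i = j then 1 else 0)"
        using quot_coordsD(4)[OF S, of j] by auto
      \<comment> \<open>Sends e to w and kills K, whose elements have last entry 0.\<close>
      let ?\<phi> = "hom_on K' (\<lambda>k. rmult (k r) w)"
      have \<phi>: "?\<phi> \<in> hom_lifts (Suc r) K'"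
      proof (rule hom_on_in_hom_lifts[OF K'])
        fix k l :: vec3
        have "rmult ((k + l) r) w - rmult (k r) w - rmult (l r) w = 0" by (simp add: rmult_simps)
        then show "rmult ((k + l) r) w - rmult (k r) w - rmult (l r) w \<in> K'"
          using submodule_0[OF K'] by (simp only:)
      next
        fix g and k :: vec3
        have "rmult (rmult g k r) w - rmult g (rmult (k r) w) = 0"
          by (simp add: rmult_def[of g k] rmult_simps)
        then show "rmult (rmult g k r) w - rmult g (rmult (k r) w) \<in> K'"
          using submodule_0[OF K'] by (simp only:)
      qed (use w(1) free_sub submodule_rmult[OF submodule_free] in auto)
      have "\<rho> ?\<phi> \<in> hom_null r K"
      proof -
        have "\<rho> ?\<phi> k = 0" for k
        proof (cases "k \<in> K")
          case True
          then have "k r = 0" using submodule_subset[OF K] by (auto simp: free_module_def)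
          then show ?thesis by (auto simp: \<rho>_def hom_on_def rmult_simps)
        qed (simp add: \<rho>_def hom_on_def)
        then show ?thesis using \<rho>[OF \<phi>] submodule_0[OF K] by (simp add: hom_null_def)
      qed
      then have "T (\<rho> ?\<phi>) i = 0" if "i < n" for i
        using quot_coordsD(3)[OF T \<rho>[OF \<phi>]] that by auto
      moreover have "tr (?\<phi> e) = w"
        using e by (simp add: tr_id[OF w(1)] rmult_simps) (simp add: e_def unit_vec_def rmult_simps)
      ultimately show ?thesis
        using 2 \<phi> w(2) by (intro bexI[of _ ?\<phi>]) (auto split: if_splits)
    qed
  qed
  have "card ?J = n + d"
    by (subst card_Un_disjoint) (auto simp: card_image)
  moreover have "rmult f v \<in> K'" if "v \<in> free_module (Suc r)" for v
    using f(1)[OF tr_free[OF that]] submodule_rmult[OF F that] by (simp add: K'_def)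
  ultimately have "quot_point (Suc r) d (n + d) K'"
    using quot_point_if_coords[OF K' _ _ S' T', of f] f(2) by simp
  then show ?thesis by blast
qed


text \<open>Let (a, 0, 0) lie outside the support of M, let W be the module of vectors whose first
  entry vanishes there, and let K' be the intersection of K and W. By the Chinese remainder theorem
  the quotient by K' is the direct sum of M and a skyscraper C at the point, and Hom(K', M + C) is
  the direct sum of Hom(K, M) and Hom(W, C). The latter has dimension r + 2: three generators of the
  maximal ideal in the first entry and r - 1 unit vectors.\<close>

lemma quot_point_Suc_length:
  assumes "quot_point r d n K" and r: "r > 0"
  shows "\<exists>K'. quot_point r (Suc d) (n + r + 2) K'"
proof -
  from assms(1) obtain S T f0 where K: "is_submodule r K"
    and S: "quot_coords vsmult (free_module r) K {..<d} S"
    and T: "quot_coords hsmult (hom_lifts r K) (hom_null r K) {..<n} T"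
    and f0: "\<And>v. v \<in> free_module r \<Longrightarrow> rmult f0 v \<in> K" and fin: "finite {a. eval_axis a f0 = 0}"
    by (rule quot_point_coords) blast
  obtain a where a: "eval_axis a f0 \<noteq> 0"
    using ex_new_if_finite[OF infinite_UNIV_char_0 fin] by auto
  \<comment> \<open>f kills M and has value 1 at the point; e = 1 - f is the identity on M and has
    value 0 at the point. They act as complementary idempotents on the new quotient.\<close>
  define f where "f = const3 (1 / eval_axis a f0) * f0"
  define e where "e = 1 - f"
  have f: "rmult f v \<in> K" if "v \<in> free_module r" for v
    using submodule_rmult[OF K f0[OF that]] by (simp add: f_def rmult_simps)
  have ev_f [simp]: "eval_axis a f = 1" using a by (simp add: f_def)
  have ev_e [simp]: "eval_axis a e = 0" by (simp add: e_def)
  have ef: "v - rmult e v \<in> K" if "v \<in> free_module r" for v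
    using f[OF that] by (simp add: e_def rmult_simps)
  define K' where "K' = {v \<in> K. eval_axis a (v 0) = 0}"
  note F = submodule_free[of r]
  have K'K: "k \<in> K" if "k \<in> K'" for k using that by (simp add: K'_def)
  have Kfree: "k \<in> free_module r" if "k \<in> K" for k using submodule_subset[OF K] that by blast
  have K': "is_submodule r K'"
    unfolding is_submodule_def
    using submodule_0[OF K] submodule_add[OF K] submodule_rmult[OF K] Kfree
    by (auto simp: K'_def) (auto simp: rmult_def)
  have eK: "rmult e k \<in> K'" if "k \<in> K" for k
    using submodule_rmult[OF K that] by (simp add: K'_def) (simp add: rmult_def)
  have fK: "rmult f v \<in> K'" if "v \<in> free_module r" "eval_axis a (v 0) = 0" for v
    using f[OF that(1)] that(2) by (simp add: K'_def) (simp add: rmult_def)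
  have u0: "unit_vec i \<in> free_module r" if "i < r" for i
    using that by (auto simp: unit_vec_def free_module_def)

  \<comment> \<open>generators of the submodule of vectors whose first entry vanishes at \<open>(a, 0, 0)\<close>\<close>
  define w where "w j = (if j = 0 then rmult (xv - const3 a) (unit_vec 0)
      else if j < r then unit_vec j
      else if j = r then rmult yv (unit_vec 0) else rmult zv (unit_vec 0))" for j :: nat
  have w_free: "w j \<in> free_module r" for j
    using u0 r submodule_rmult[OF F] by (auto simp: w_def)
  have w_ev: "eval_axis a (w j 0) = 0" for j
    by (auto simp: w_def rmult_def unit_vec_def)
  have fw: "rmult f (w j) \<in> K'" for j by (intro fK w_free w_ev)
  \<comment> \<open>W is generated by the r + 2 vectors \<open>w j\<close>, put as an induction
    principle.\<close>
  have gen: "P v" if v: "v \<in> free_module r" "eval_axis a (v 0) = 0"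
    and w: "\<And>j. j < r + 2 \<Longrightarrow> P (w j)" and P0: "P 0"
    and add: "\<And>u v. u \<in> free_module r \<Longrightarrow> v \<in> free_module r \<Longrightarrow> eval_axis a (u 0) = 0 \<Longrightarrow> eval_axis a (v 0) = 0
      \<Longrightarrow> P u \<Longrightarrow> P v \<Longrightarrow> P (u + v)"
    and mult: "\<And>g u. u \<in> free_module r \<Longrightarrow> eval_axis a (u 0) = 0 \<Longrightarrow> P u \<Longrightarrow> P (rmult g u)" for P v
  proof -
    define Q where "Q u \<longleftrightarrow> u \<in> free_module r \<and> eval_axis a (u 0) = 0 \<and> P u" for u
    have Q0: "Q 0" using P0 submodule_0[OF F] by (simp add: Q_def)
    have Qadd: "Q (u + v)" if "Q u" "Q v" for u v
      using that add submodule_add[OF F] by (simp add: Q_def)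
    have Qmult: "Q (rmult g u)" if "Q u" for u g
      using that mult submodule_rmult[OF F] by (auto simp: Q_def) (simp add: rmult_def)
    have Qw: "Q (w j)" if "j < r + 2" for j using that w w_free w_ev by (simp add: Q_def)
    obtain s t u where stu: "v 0 - const3 (eval_axis a (v 0)) = s * (xv - const3 a) + t * yv + u * zv"
      using eval_axis_decompose[of "v 0" a] by (elim exE)
    have "Q (rmult s (w 0) + rmult t (w r) + rmult u (w (r + 1)))"
      using r by (intro Qadd Qmult Qw) auto
    moreover have "rmult s (w 0) + rmult t (w r) + rmult u (w (r + 1)) = rmult (v 0) (unit_vec 0)"
      using r v(2) stu by (auto simp: w_def rmult_def unit_vec_def fun_eq_iff)
    moreover have "Q (\<Sum>j\<in>{1..<r}. rmult (v j) (unit_vec j))"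
    proof (rule sum_closed[of _ Q])
      fix j assume "j \<in> {1..<r}"
      then have "Q (unit_vec j)" using Qw[of j] by (simp add: w_def)
      then show "Q (rmult (v j) (unit_vec j))" by (rule Qmult)
    qed (auto intro: Q0 Qadd)
    ultimately have "Q (rmult (v 0) (unit_vec 0) + (\<Sum>j\<in>{1..<r}. rmult (v j) (unit_vec j)))"
      by (intro Qadd) auto
    moreover have "rmult (v 0) (unit_vec 0) + (\<Sum>j\<in>{1..<r}. rmult (v j) (unit_vec j)) = v"
    proof
      fix i
      have "(\<Sum>j\<in>A. rmult (v j) (unit_vec j)) i = (\<Sum>j\<in>A. if j = i then v j else 0)" if "finite A" for A
        using that by induction (auto simp: rmult_def unit_vec_def)
      then show "(rmult (v 0) (unit_vec 0) + (\<Sum>j\<in>{1..<r}. rmult (v j) (unit_vec j))) i = v i"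
        using v(1) by (auto simp: rmult_def unit_vec_def free_module_def)
    qed
    ultimately show ?thesis by (simp add: Q_def)
  qed

  \<comment> \<open>Multiplication by e takes K into K' and is the identity on M, so this recovers
    the Hom(K, M) part. The other part is read off on f W, which also lies in K'.\<close>
  define \<rho> where "\<rho> \<phi> = hom_on K (\<lambda>k. \<phi> (rmult e k))" for \<phi> :: "vec3 \<Rightarrow> vec3"
  have \<rho>: "\<rho> \<phi> \<in> hom_lifts r K" if \<phi>: "\<phi> \<in> hom_lifts r K'" for \<phi>
    unfolding \<rho>_def
  proof (rule hom_on_in_hom_lifts[OF K])
    fix k l assume "k \<in> K" "l \<in> K"
    with hom_lifts_add[OF \<phi> eK eK] K'K
    show "\<phi> (rmult e (k + l)) - \<phi> (rmult e k) - \<phi> (rmult e l) \<in> K"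
      by (simp add: rmult_simps)
  next
    fix g k assume "k \<in> K"
    with hom_lifts_rmult[OF \<phi> eK] K'K
    show "\<phi> (rmult e (rmult g k)) - rmult g (\<phi> (rmult e k)) \<in> K"
      by (simp add: rmult_left_commute[of e])
  qed (use hom_lifts_free[OF \<phi>] in auto)

  let ?S = "\<lambda>v i. if i < d then S v i else eval_axis a (v 0)"
  have S': "quot_coords vsmult (free_module r) K' {..<Suc d} ?S"
    unfolding quot_coords_def
  proof (intro conjI ballI allI)
    fix v assume "v \<in> free_module r"
    then show "v \<in> K' \<longleftrightarrow> (\<forall>i\<in>{..<Suc d}. ?S v i = 0)"
      by (auto simp: K'_def quot_coordsD(3)[OF S] less_Suc_eq)
  next
    fix i assume "i \<in> {..<Suc d}"
    then consider "i < d" | "i = d" by (auto simp: less_Suc_eq)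
    then show "\<exists>b\<in>free_module r. \<forall>j\<in>{..<Suc d}. ?S b j = (if j = i then 1 else 0)"
    proof cases
      case 1
      then obtain b where b: "b \<in> free_module r" "\<forall>j<d. S b j = (if j = i then 1 else 0)"
        using quot_coordsD(4)[OF S, of i] by auto
      \<comment> \<open>e b agrees with b modulo K and vanishes at the new point. In the other case
        f times \<open>unit_vec 0\<close> lies in K and has value 1 there.\<close>
      have "S (rmult e b) j = S b j" if "j < d" for j
        using that by (intro quot_coords_cong[OF vector_space_vsmult subspace_submodule[OF F] S, symmetric] ef
          submodule_rmult[OF F] b(1)) auto
      moreover have "eval_axis a (rmult e b 0) = 0" by (simp add: rmult_def)
      ultimately show ?thesis
        using b 1 submodule_rmult[OF F b(1)] by (intro bexI[of _ "rmult e b"]) auto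
    next
      case 2
      let ?b = "rmult f (unit_vec 0)"
      have "?b \<in> K" using f u0 r by simp
      moreover from this have "S ?b j = 0" if "j < d" for j
        using quot_coordsD(3)[OF S Kfree] that by auto
      moreover have "eval_axis a (?b 0) = 1" by (simp add: rmult_def unit_vec_def)
      ultimately show ?thesis
        using 2 Kfree by (intro bexI[of _ ?b]) auto
    qed
  qed (auto simp: quot_coordsD(1,2)[OF S] eval_axis_vsmult)

  let ?J = "Inl ` {..<n} \<union> Inr ` {..<r + 2}"
  let ?T = "\<lambda>\<phi>. case_sum (T (\<rho> \<phi>)) (\<lambda>j. eval_axis a (\<phi> (rmult f (w j)) 0))"
  have T': "quot_coords hsmult (hom_lifts r K') (hom_null r K') ?J ?T"
    unfolding quot_coords_def
  proof (intro conjI ballI allI)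
    fix \<phi> \<psi> i assume h: "\<phi> \<in> hom_lifts r K'" "\<psi> \<in> hom_lifts r K'" and i: "i \<in> ?J"
    have "\<rho> (\<phi> + \<psi>) = \<rho> \<phi> + \<rho> \<psi>" by (simp add: \<rho>_def hom_on_plus)
    then show "?T (\<phi> + \<psi>) i = ?T \<phi> i + ?T \<psi> i"
      using i \<rho>[OF h(1)] \<rho>[OF h(2)] by (auto simp: quot_coordsD(1)[OF T])
  next
    fix c \<phi> i assume h: "\<phi> \<in> hom_lifts r K'" and i: "i \<in> ?J"
    have "\<rho> (hsmult c \<phi>) = hsmult c (\<rho> \<phi>)" by (simp add: \<rho>_def hsmult_def[of c \<phi>] hom_on_hsmult)
    then show "?T (hsmult c \<phi>) i = c * ?T \<phi> i"
      using i \<rho>[OF h]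
      by (auto simp: quot_coordsD(2)[OF T] hsmult_def[of c \<phi>] vsmult_def rmult_def)
  next
    fix \<phi> assume h: "\<phi> \<in> hom_lifts r K'"
    \<comment> \<open>After evaluation of the first entry the congruences modulo K' become
      equalities, with R acting through its values at (a, 0, 0).\<close>
    have ev_add: "eval_axis a (\<phi> (k + l) 0) = eval_axis a (\<phi> k 0) + eval_axis a (\<phi> l 0)"
      if "k \<in> K'" "l \<in> K'" for k l
      using hom_lifts_add[OF h that] by (simp add: K'_def diff_eq_eq add.commute)
    have ev_mult: "eval_axis a (\<phi> (rmult g k) 0) = eval_axis a g * eval_axis a (\<phi> k 0)"
      if "k \<in> K'" for k g
      using hom_lifts_rmult[OF h that, of g] by (simp add: K'_def) (simp add: rmult_def)
    have "\<phi> \<in> hom_null r K' \<longleftrightarrow> \<rho> \<phi> \<in> hom_null r K \<and> (\<forall>j<r + 2. eval_axis a (\<phi> (rmult f (w j)) 0) = 0)"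
    proof
      assume "\<phi> \<in> hom_null r K'"
      then show "\<rho> \<phi> \<in> hom_null r K \<and> (\<forall>j<r + 2. eval_axis a (\<phi> (rmult f (w j)) 0) = 0)"
        using \<rho>[OF h] submodule_0[OF K] by (auto simp: hom_null_def \<rho>_def hom_on_def K'_def)
    next
      assume *: "\<rho> \<phi> \<in> hom_null r K \<and> (\<forall>j<r + 2. eval_axis a (\<phi> (rmult f (w j)) 0) = 0)"
      \<comment> \<open>\<open>\<phi> k\<close> lies in K because e is the identity modulo K. Its
        first entry vanishes at the point because f has value 1 there and f k is controlled by the
        \<open>rmult f (w j)\<close>.\<close>
      have "\<phi> k \<in> K'" if k: "k \<in> K'" for k
      proof -
        have "\<phi> (rmult e k) \<in> K"
          using * K'K[OF k] by (auto simp: hom_null_def \<rho>_def dest: spec[of _ k])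
        then have "rmult e (\<phi> k) \<in> K"
          using submodule_diff_iff[OF K K'K[OF hom_lifts_rmult[OF h k, of e]]] by simp
        then have "\<phi> k \<in> K"
          using submodule_diff_iff[OF K ef[OF hom_lifts_free[OF h, of k]]] by simp
        moreover have "eval_axis a (\<phi> (rmult f k) 0) = 0"
        proof (rule gen[of k "\<lambda>k. eval_axis a (\<phi> (rmult f k) 0) = 0"])
          show "k \<in> free_module r" "eval_axis a (k 0) = 0" using k Kfree by (auto simp: K'_def)
          show "eval_axis a (\<phi> (rmult f 0) 0) = 0"
            using hom_lifts_0[OF K' h] by (simp add: rmult_simps K'_def)
        qed (use * in \<open>auto simp: rmult_simps ev_add fK rmult_left_commute[of f] ev_mult\<close>)
        then have "eval_axis a (\<phi> k 0) = 0" using k by (simp add: ev_mult)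
        ultimately show ?thesis by (simp add: K'_def)
      qed
      then show "\<phi> \<in> hom_null r K'"
        using h submodule_0[OF K'] hom_lifts_outside[OF h] by (auto simp: hom_null_def) metis
    qed
    then show "\<phi> \<in> hom_null r K' \<longleftrightarrow> (\<forall>i\<in>?J. ?T \<phi> i = 0)"
      using \<rho>[OF h] by (auto simp: quot_coordsD(3)[OF T] ball_Un)
  next
    fix i assume "i \<in> ?J"
    then consider j where "i = Inl j" "j < n" | j where "i = Inr j" "j < r + 2" by auto
    then show "\<exists>b\<in>hom_lifts r K'. \<forall>j\<in>?J. ?T b j = (if j = i then 1 else 0)"
    proof cases
      case (1 j)
      then obtain \<psi> where \<psi>: "\<psi> \<in> hom_lifts r K" "\<forall>i<n. T \<psi> i = (if i = j then 1 else 0)"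
        using quot_coordsD(4)[OF T, of j] by auto
      let ?\<phi> = "hom_on K' (\<lambda>k. rmult e (\<psi> k))"
      have \<phi>: "?\<phi> \<in> hom_lifts r K'"
      proof (rule hom_on_in_hom_lifts[OF K'])
        fix k l assume "k \<in> K'" "l \<in> K'"
        with eK[OF hom_lifts_add[OF \<psi>(1) K'K K'K]]
        show "rmult e (\<psi> (k + l)) - rmult e (\<psi> k) - rmult e (\<psi> l) \<in> K'"
          by (simp add: rmult_simps)
      next
        fix g k assume "k \<in> K'"
        with eK[OF hom_lifts_rmult[OF \<psi>(1) K'K]]
        show "rmult e (\<psi> (rmult g k)) - rmult g (rmult e (\<psi> k)) \<in> K'"
          by (simp add: rmult_simps rmult_left_commute[of e])
      qed (use hom_lifts_free[OF \<psi>(1)] submodule_rmult[OF F] in auto)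
      \<comment> \<open>On K both sides agree modulo K, as e acts there as the identity before and
        after \<open>\<psi>\<close>.\<close>
      have "\<psi> - \<rho> ?\<phi> \<in> hom_null r K"
      proof -
        have "(\<psi> - \<rho> ?\<phi>) k \<in> K" for k
        proof (cases "k \<in> K")
          case True
          have "\<psi> k - rmult e (\<psi> k) \<in> K" "rmult e (\<psi> k) - rmult e (rmult e (\<psi> k)) \<in> K"
            using hom_lifts_free[OF \<psi>(1)] submodule_rmult[OF F] by (auto intro: ef)
          from submodule_diff[OF K submodule_add[OF K this] submodule_rmult[OF K hom_lifts_rmult[OF \<psi>(1) True, of e], of e]]
          show ?thesis using True eK by (simp add: \<rho>_def rmult_simps algebra_simps)
        next
          case False
          then show ?thesis
            using hom_lifts_outside[OF \<psi>(1)] submodule_0[OF K] by (simp add: \<rho>_def hom_on_def)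
        qed
        moreover have "\<psi> - \<rho> ?\<phi> \<in> hom_lifts r K"
        proof -
          interpret vector_space hsmult by (rule vector_space_hsmult)
          show ?thesis by (rule subspace_diff[OF subspace_hom_lifts[OF K] \<psi>(1) \<rho>[OF \<phi>]])
        qed
        ultimately show ?thesis by (simp add: hom_null_def)
      qed
      then have "T (\<rho> ?\<phi>) i = T \<psi> i" if "i < n" for i
        using that by (intro quot_coords_cong[OF vector_space_hsmult subspace_hom_lifts[OF K] T, symmetric] \<psi>(1) \<rho>[OF \<phi>]) auto
      moreover have "eval_axis a (?\<phi> (rmult f (w j)) 0) = 0" for j
        using fw by simp (simp add: rmult_def)
      ultimately show ?thesis
        using 1 \<phi> \<psi>(2) by (intro bexI[of _ ?\<phi>]) (auto split: if_splits)
    next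
      case (2 j)
      \<comment> \<open>The functional on W dual to \<open>w j\<close>: a first derivative of the
        first entry at the point, or the value of another entry. It kills the maximal ideal of the
        point times W, so multiplying it by f times \<open>unit_vec 0\<close>, which spans the
        skyscraper, gives a homomorphism.\<close>
      define \<tau> where "\<tau> k = (if j = 0 then eval_axis a (dx (k 0)) else if j < r then eval_axis a (k j)
        else if j = r then eval_axis a (dy (k 0)) else eval_axis a (dz (k 0)))" for k :: vec3
      have \<tau>: "\<tau> (k + l) = \<tau> k + \<tau> l" "\<tau> (rmult (const3 c) k) = c * \<tau> k" for k l c
        by (auto simp: \<tau>_def rmult_def dx_simps dy_simps dz_simps)
      have \<tau>_var: "\<tau> (rmult xv k) = a * \<tau> k" "\<tau> (rmult yv k) = 0" "\<tau> (rmult zv k) = 0"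
        if "eval_axis a (k 0) = 0" for k
        using that by (auto simp: \<tau>_def rmult_def dx_simps dy_simps dz_simps)
      let ?\<phi> = "hom_on K' (\<lambda>k. rmult (const3 (\<tau> k)) (rmult f (unit_vec 0)))"
      have fvK: "rmult f (rmult (xv - const3 a) (unit_vec 0)) \<in> K'"
        "rmult f (rmult yv (unit_vec 0)) \<in> K'" "rmult f (rmult zv (unit_vec 0)) \<in> K'"
        using fw[of 0] fw[of r] fw[of "r + 1"] r by (auto simp: w_def)
      have \<phi>: "?\<phi> \<in> hom_lifts r K'"
      proof (rule linear_hom_on_in_hom_lifts[OF K'])
        fix k assume "k \<in> K'"
        then have k: "eval_axis a (k 0) = 0" by (simp add: K'_def)
        show "rmult (const3 (\<tau> k)) (rmult f (unit_vec 0)) \<in> free_module r"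
          using r u0 submodule_rmult[OF F] by simp
        show "rmult (const3 (\<tau> (rmult xv k))) (rmult f (unit_vec 0))
            - rmult xv (rmult (const3 (\<tau> k)) (rmult f (unit_vec 0))) \<in> K'"
          using submodule_rmult[OF K' fvK(1), of "- const3 (\<tau> k)"]
          by (simp add: \<tau>_var[of k, OF k]) (simp add: rmult_def const3_mult algebra_simps fun_diff_def)
        show "rmult (const3 (\<tau> (rmult yv k))) (rmult f (unit_vec 0))
            - rmult yv (rmult (const3 (\<tau> k)) (rmult f (unit_vec 0))) \<in> K'"
          using submodule_rmult[OF K' fvK(2), of "- const3 (\<tau> k)"]
          by (simp add: \<tau>_var[of k, OF k]) (simp add: rmult_def algebra_simps fun_diff_def)
        show "rmult (const3 (\<tau> (rmult zv k))) (rmult f (unit_vec 0))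
            - rmult zv (rmult (const3 (\<tau> k)) (rmult f (unit_vec 0))) \<in> K'"
          using submodule_rmult[OF K' fvK(3), of "- const3 (\<tau> k)"]
          by (simp add: \<tau>_var[of k, OF k]) (simp add: rmult_def algebra_simps fun_diff_def)
      qed (auto simp: \<tau> rmult_simps const3_add const3_mult)
      have "\<rho> ?\<phi> \<in> hom_null r K"
      proof -
        have "\<rho> ?\<phi> k \<in> K" for k
          using eK submodule_0[OF K] submodule_rmult[OF K f[OF u0[OF r]]]
          by (auto simp: \<rho>_def hom_on_def)
        then show ?thesis using \<rho>[OF \<phi>] by (simp add: hom_null_def)
      qed
      then have "T (\<rho> ?\<phi>) i = 0" if "i < n" for i
        using quot_coordsD(3)[OF T \<rho>[OF \<phi>]] that by auto
      moreover have "eval_axis a (?\<phi> (rmult f (w i)) 0) = (if i = j then 1 else 0)" if i: "i < r + 2" for i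
      proof -
        have "eval_axis a (?\<phi> (rmult f (w i)) 0) = \<tau> (rmult f (w i))"
          using fw by simp (simp add: rmult_def unit_vec_def)
        \<comment> \<open>The factor from \<open>w\<close> goes to the left, where the product rules
          for the variables apply.\<close>
        also have "\<tau> (rmult f (w i)) = \<tau> (\<lambda>l. w i l * f)"
          by (simp add: rmult_def mult.commute)
        also have "\<dots> = (if i = j then 1 else 0)"
          using i 2 r
          by (auto simp: \<tau>_def w_def rmult_def unit_vec_def left_diff_distrib dx_simps dy_simps dz_simps)
        finally show ?thesis .
      qed
      ultimately show ?thesis
        using 2 \<phi> by (intro bexI[of _ ?\<phi>]) (auto split: if_splits)
    qed
  qed
  have "card ?J = n + r + 2"
    by (subst card_Un_disjoint) (auto simp: card_image)
  \<comment> \<open>The factor x - a kills the skyscraper and adds only the zero a on the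
    axis.\<close>
  moreover have "rmult ((xv - const3 a) * f) v \<in> K'" if "v \<in> free_module r" for v
    using submodule_rmult[OF K f[OF that], of "xv - const3 a"]
    by (simp add: K'_def rmult_simps(5)) (simp add: rmult_def)
  moreover have "finite {b. eval_axis b ((xv - const3 a) * f) = 0}"
    using fin by (auto simp: f_def a)
  ultimately have "quot_point r (Suc d) (n + r + 2) K'"
    using quot_point_if_coords[OF K' _ _ S' T', of "(xv - const3 a) * f"] by simp
  then show ?thesis by blast
qed

section \<open>Submodules cut out by coefficient functionals\<close>

definition mono_vec :: "nat \<times> nat \<times> nat \<times> nat \<Rightarrow> vec3" where
  "mono_vec = (\<lambda>(i, m). rmult (Poly_Mapping.single m 1) (unit_vec i))"

lemma mono_vec_apply: "mono_vec (i, m) l = (if l = i then Poly_Mapping.single m 1 else 0)"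
  by (simp add: mono_vec_def rmult_def unit_vec_def)

lemma vec_eq_sum_unit_vec:
  assumes "v \<in> free_module r"
  shows "v = (\<Sum>i<r. rmult (v i) (unit_vec i))"
proof
  fix l
  have "(\<Sum>i\<in>A. rmult (v i) (unit_vec i)) l = (\<Sum>i\<in>A. if i = l then v i else 0)" if "finite A" for A
    using that by induction (auto simp: rmult_def unit_vec_def)
  then show "v l = (\<Sum>i<r. rmult (v i) (unit_vec i)) l"
    using assms by (auto simp: free_module_def)
qed

lemma mem_submodule_if_monomials:
  assumes Q: "is_submodule r Q" and v: "v \<in> free_module r"
    and m: "\<And>i m. i < r \<Longrightarrow> lookup3 (v i) m \<noteq> 0 \<Longrightarrow> mono_vec (i, m) \<in> Q"
  shows "v \<in> Q"
proof -
  have "rmult p (unit_vec i) \<in> Q" if "\<And>m. lookup3 p m \<noteq> 0 \<Longrightarrow> mono_vec (i, m) \<in> Q" for p i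
  proof -
    have "rmult (\<Sum>m\<in>Poly_Mapping.keys p. Poly_Mapping.single m (lookup3 p m)) (unit_vec i) \<in> Q"
    proof (rule sum_closed[of _ "\<lambda>p. rmult p (unit_vec i) \<in> Q"])
      fix m assume "m \<in> Poly_Mapping.keys p"
      then have "mono_vec (i, m) \<in> Q" using that by (simp add: in_keys_iff)
      from submodule_rmult[OF Q this, of "const3 (lookup3 p m)"]
      show "rmult (Poly_Mapping.single m (lookup3 p m)) (unit_vec i) \<in> Q"
        by (simp add: mono_vec_def const3_def mult_single flip: rmult_simps(5))
    qed (use submodule_0[OF Q] submodule_add[OF Q] in \<open>auto simp: rmult_simps\<close>)
    then show ?thesis by (simp flip: poly3_eq_sum_monomials)
  qed
  with m have "(\<Sum>i<r. rmult (v i) (unit_vec i)) \<in> Q"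
    using submodule_0[OF Q] submodule_add[OF Q]
    by (intro sum_closed[of _ "\<lambda>v. v \<in> Q"]) auto
  then show ?thesis using vec_eq_sum_unit_vec[OF v] by simp
qed

lemma mono_vec_mem_if_le:
  assumes Q: "is_submodule r Q" and "mono_vec (i, a', b', c') \<in> Q" and "a' \<le> a" "b' \<le> b" "c' \<le> c"
  shows "mono_vec (i, a, b, c) \<in> Q"
  using submodule_rmult[OF Q assms(2), of "Poly_Mapping.single (a - a', b - b', c - c') 1"] assms(3-)
  by (simp add: mono_vec_def mult_single flip: rmult_simps(5))

definition linear_functional :: "(vec3 \<Rightarrow> complex) \<Rightarrow> bool" where
  "linear_functional l \<longleftrightarrow> (\<forall>u v. l (u + v) = l u + l v) \<and> (\<forall>c v. l (rmult (const3 c) v) = c * l v)"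

lemma linear_functionalD:
  assumes "linear_functional l"
  shows "l (u + v) = l u + l v" "l (rmult (const3 c) v) = c * l v" "l (vsmult c v) = c * l v"
    "l 0 = 0" "l (u - v) = l u - l v"
proof -
  show add: "l (u + v) = l u + l v" and scale: "l (rmult (const3 c) v) = c * l v" for u v c
    using assms by (auto simp: linear_functional_def)
  show "l (vsmult c v) = c * l v" by (simp add: vsmult_def scale)
  show "l 0 = 0" using scale[of 0 0] by (simp add: rmult_simps)
  show "l (u - v) = l u - l v" using add[of "u - v" v] by simp
qed

text \<open>Closure under the variables gives closure under R. The examples are presented in this
  way because the same functionals then serve as coordinates on M.\<close>

lemma common_kernel_is_submodule:
  assumes c: "\<And>j. j \<in> J \<Longrightarrow> linear_functional (c j)"
    and xyz: "\<And>v j. \<forall>j\<in>J. c j v = 0 \<Longrightarrow> j \<in> J \<Longrightarrow>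
      c j (rmult xv v) = 0 \<and> c j (rmult yv v) = 0 \<and> c j (rmult zv v) = 0"
  shows "is_submodule r {v \<in> free_module r. \<forall>j\<in>J. c j v = 0}"
proof -
  have "c j (rmult f v) = 0" if v: "\<forall>j\<in>J. c j v = 0" and j: "j \<in> J" for f v j
  proof -
    have "\<forall>j\<in>J. c j (rmult f v) = 0"
      by (rule poly3_induct[of "\<lambda>f. \<forall>j\<in>J. c j (rmult f v) = 0"])
        (use v xyz in \<open>auto simp: linear_functionalD[OF c] rmult_simps\<close>)
    then show ?thesis using j by blast
  qed
  then show ?thesis
    using submodule_free[of r] unfolding is_submodule_def
    by (auto simp: linear_functionalD[OF c])
qed

text \<open>Think of \<open>l\<close>, \<open>ly\<close>, \<open>lz\<close> as the coefficients at \<open>1\<close>, \<open>y\<close>, \<open>z\<close> of the multiplier of one generator: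
  the map sends this generator to \<open>b\<close> and the other ones to zero.\<close>

lemma functional_hom_in_hom_lifts:
  assumes K: "is_submodule r K" and b: "b \<in> free_module r"
    and lin: "linear_functional l" "linear_functional ly" "linear_functional lz"
    and l: "\<And>k. k \<in> K \<Longrightarrow> l (rmult xv k) = 0 \<and> l (rmult yv k) = 0 \<and> l (rmult zv k) = 0"
    and ly: "\<And>k. k \<in> K \<Longrightarrow> ly (rmult xv k) = 0 \<and> ly (rmult yv k) = l k \<and> ly (rmult zv k) = 0"
    and lz: "\<And>k. k \<in> K \<Longrightarrow> lz (rmult xv k) = 0 \<and> lz (rmult yv k) = 0 \<and> lz (rmult zv k) = l k"
    and bK: "rmult xv b \<in> K" "rmult (yv * yv) b \<in> K" "rmult (yv * zv) b \<in> K" "rmult (zv * zv) b \<in> K"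
  shows "hom_on K (\<lambda>k. rmult (const3 (l k) + const3 (ly k) * yv + const3 (lz k) * zv) b) \<in> hom_lifts r K"
    (is "hom_on K ?L \<in> _")
proof (rule linear_hom_on_in_hom_lifts[OF K])
  \<comment> \<open>b is killed modulo K by J = (x, y^2, yz, z^2), and l + ly y + lz z is an
    R-linear map from K to R/J, which has basis 1, y, z. Each defect is therefore an element of J
    times b.\<close>
  have comb: "rmult p b \<in> K" if "p = f * xv + g * (yv * yv) + h * (yv * zv) + i * (zv * zv)" for p f g h i
    unfolding that rmult_simps(2) rmult_simps(5)[of f] rmult_simps(5)[of g] rmult_simps(5)[of h] rmult_simps(5)[of i]
    using bK by (blast intro: submodule_add[OF K] submodule_rmult[OF K])
  fix k assume k: "k \<in> K"
  show "?L k \<in> free_module r" using submodule_rmult[OF submodule_free b] .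
  have "- (const3 (l k) + const3 (ly k) * yv + const3 (lz k) * zv) * xv
      = - (const3 (l k) + const3 (ly k) * yv + const3 (lz k) * zv) * xv + 0 * (yv * yv) + 0 * (yv * zv) + 0 * (zv * zv)"
    by simp
  from comb[OF this] show "?L (rmult xv k) - rmult xv (?L k) \<in> K"
    using l[OF k] ly[OF k] lz[OF k]
    by (simp add: rmult_simps) (simp add: rmult_def algebra_simps fun_diff_def)
  have "- (const3 (ly k) * (yv * yv) + const3 (lz k) * (yv * zv))
      = 0 * xv + (- const3 (ly k)) * (yv * yv) + (- const3 (lz k)) * (yv * zv) + 0 * (zv * zv)"
    by simp
  from comb[OF this] show "?L (rmult yv k) - rmult yv (?L k) \<in> K"
    using l[OF k] ly[OF k] lz[OF k]
    by (simp add: rmult_def algebra_simps fun_diff_def)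
  have "- (const3 (ly k) * (yv * zv) + const3 (lz k) * (zv * zv))
      = 0 * xv + 0 * (yv * yv) + (- const3 (ly k)) * (yv * zv) + (- const3 (lz k)) * (zv * zv)"
    by simp
  from comb[OF this] show "?L (rmult zv k) - rmult zv (?L k) \<in> K"
    using l[OF k] ly[OF k] lz[OF k]
    by (simp add: rmult_def algebra_simps fun_diff_def)
next
  note lin_simps = linear_functionalD[OF lin(1)] linear_functionalD[OF lin(2)] linear_functionalD[OF lin(3)]
  fix k k' show "?L (k + k') = ?L k + ?L k'"
    by (simp add: lin_simps const3_add) (simp add: rmult_def fun_eq_iff algebra_simps)
  fix c show "?L (rmult (const3 c) k) = rmult (const3 c) (?L k)"
    by (simp add: lin_simps const3_mult) (simp add: rmult_def fun_eq_iff algebra_simps)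
qed

text \<open>The composite of a map K/mK to C with the map from C to M that hits the socle element
  b.\<close>

lemma socle_hom_in_hom_lifts:
  assumes K: "is_submodule r K" and b: "b \<in> free_module r" and lin: "linear_functional l"
    and l: "\<And>k. k \<in> K \<Longrightarrow> l (rmult xv k) = 0 \<and> l (rmult yv k) = 0 \<and> l (rmult zv k) = 0"
    and bK: "rmult xv b \<in> K" "rmult yv b \<in> K" "rmult zv b \<in> K"
  shows "hom_on K (\<lambda>k. rmult (const3 (l k)) b) \<in> hom_lifts r K"
proof (rule linear_hom_on_in_hom_lifts[OF K])
  have comb: "0 - rmult v (rmult (const3 c) b) \<in> K" if "rmult v b \<in> K" for v c
    using submodule_uminus[OF K submodule_rmult[OF K that, of "const3 c"]]
    by (simp add: rmult_left_commute[of v])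
  fix k assume k: "k \<in> K"
  show "rmult (const3 (l k)) b \<in> free_module r" using submodule_rmult[OF submodule_free b] .
  show "rmult (const3 (l (rmult xv k))) b - rmult xv (rmult (const3 (l k)) b) \<in> K"
    "rmult (const3 (l (rmult yv k))) b - rmult yv (rmult (const3 (l k)) b) \<in> K"
    "rmult (const3 (l (rmult zv k))) b - rmult zv (rmult (const3 (l k)) b) \<in> K"
    using l[OF k] comb[OF bK(1)] comb[OF bK(2)] comb[OF bK(3)] by (simp_all add: rmult_simps(7))
qed (simp_all add: linear_functionalD[OF lin] rmult_simps const3_add const3_mult)

text \<open>In the Leibniz rule the term (df) k lies in K, so a derivation is R-linear from K to M.
  This is the tangent vector of translation along the x-axis.\<close>

lemma dx_hom_in_hom_lifts:
  assumes K: "is_submodule r K"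
  shows "hom_on K (\<lambda>k i. dx (k i)) \<in> hom_lifts r K"
proof (rule linear_hom_on_in_hom_lifts[OF K])
  fix k assume k: "k \<in> K"
  show "(\<lambda>i. dx (k i)) \<in> free_module r"
    using submodule_subset[OF K] k by (auto simp: free_module_def dx_simps)
  have "(\<lambda>i. dx (rmult xv k i)) - rmult xv (\<lambda>i. dx (k i)) = k"
    by (simp add: rmult_def dx_simps fun_diff_def)
  then show "(\<lambda>i. dx (rmult xv k i)) - rmult xv (\<lambda>i. dx (k i)) \<in> K" using k by (simp only:)
  have "(\<lambda>i. dx (rmult yv k i)) - rmult yv (\<lambda>i. dx (k i)) = 0"
    by (simp add: rmult_def dx_simps)
  then show "(\<lambda>i. dx (rmult yv k i)) - rmult yv (\<lambda>i. dx (k i)) \<in> K"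
    using submodule_0[OF K] by (simp only:)
  have "(\<lambda>i. dx (rmult zv k i)) - rmult zv (\<lambda>i. dx (k i)) = 0"
    by (simp add: rmult_def dx_simps)
  then show "(\<lambda>i. dx (rmult zv k i)) - rmult zv (\<lambda>i. dx (k i)) \<in> K"
    using submodule_0[OF K] by (simp only:)
qed (auto simp: rmult_def dx_simps fun_eq_iff)

text \<open>The coordinates of a homomorphism are those coefficients of its values on generators
  that A selects. \<open>dual\<close> shows that they are independent, \<open>determined\<close>
  that no further ones are required.\<close>

lemma quot_point_if_generators:
  fixes c :: "'j \<Rightarrow> vec3 \<Rightarrow> complex" and g :: "'i \<Rightarrow> vec3"
  assumes K: "is_submodule r K" and K_def: "K = {v \<in> free_module r. \<forall>j\<in>J. c j v = 0}"
    and c: "\<And>j. j \<in> J \<Longrightarrow> linear_functional (c j)"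
    and b: "\<And>j. j \<in> J \<Longrightarrow> b j \<in> free_module r \<and> (\<forall>i\<in>J. c i (b j) = (if i = j then 1 else 0))"
    and g: "\<And>i. i \<in> G \<Longrightarrow> g i \<in> K"
    and gen: "\<And>Q. is_submodule r Q \<Longrightarrow> (\<And>i. i \<in> G \<Longrightarrow> g i \<in> Q) \<Longrightarrow> K \<subseteq> Q"
    and A: "A \<subseteq> G \<times> J" and fin: "finite J" "finite A"
    and dual: "\<And>p. p \<in> A \<Longrightarrow> \<exists>h\<in>hom_lifts r K. \<forall>(i, j)\<in>A. c j (h (g i)) = (if (i, j) = p then 1 else 0)"
    and determined: "\<And>\<phi> i. \<phi> \<in> hom_lifts r K \<Longrightarrow> \<forall>(i, j)\<in>A. c j (\<phi> (g i)) = 0 \<Longrightarrow> i \<in> G \<Longrightarrow> \<phi> (g i) \<in> K"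
    and f: "\<And>v. v \<in> free_module r \<Longrightarrow> rmult f v \<in> K" "finite {a. eval_axis a f = 0}"
  shows "quot_point r (card J) (card A) K"
proof (rule quot_point_if_coords[OF K fin _ _ f])
  show "quot_coords vsmult (free_module r) K J (\<lambda>v j. c j v)"
    unfolding quot_coords_def
  proof (intro conjI ballI allI)
    show "\<exists>v\<in>free_module r. \<forall>j\<in>J. c j v = (if j = i then 1 else 0)" if "i \<in> J" for i
      using b[OF that] by blast
  qed (auto simp: K_def linear_functionalD[OF c])
  show "quot_coords hsmult (hom_lifts r K) (hom_null r K) A (\<lambda>\<phi> (i, j). c j (\<phi> (g i)))"
    unfolding quot_coords_def
  proof (intro conjI ballI allI)
    fix \<phi> assume \<phi>: "\<phi> \<in> hom_lifts r K"
    show "\<phi> \<in> hom_null r K \<longleftrightarrow> (\<forall>p\<in>A. (case p of (i, j) \<Rightarrow> c j (\<phi> (g i))) = 0)"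
    proof
      assume "\<phi> \<in> hom_null r K"
      then show "\<forall>p\<in>A. (case p of (i, j) \<Rightarrow> c j (\<phi> (g i))) = 0"
        using A by (auto simp: hom_null_def K_def)
    next
      assume "\<forall>p\<in>A. (case p of (i, j) \<Rightarrow> c j (\<phi> (g i))) = 0"
      then have *: "\<phi> (g i) \<in> K" if "i \<in> G" for i
        using determined[OF \<phi> _ that] by (auto simp: case_prod_beta)
      \<comment> \<open>The kernel of the induced homomorphism contains the generators, hence is all
        of K.\<close>
      have "is_submodule r {k \<in> K. \<phi> k \<in> K}"
        unfolding is_submodule_def
      proof (intro conjI ballI allI)
        fix u v assume uv: "u \<in> {k \<in> K. \<phi> k \<in> K}" "v \<in> {k \<in> K. \<phi> k \<in> K}"
        then have "\<phi> (u + v) \<in> K"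
          using submodule_diff_iff[OF K] hom_lifts_add[OF \<phi>, of u v] by blast
        then show "u + v \<in> {k \<in> K. \<phi> k \<in> K}" using uv submodule_add[OF K] by auto
      next
        fix p v assume v: "v \<in> {k \<in> K. \<phi> k \<in> K}"
        then have "\<phi> (rmult p v) \<in> K"
          using submodule_diff_iff[OF K hom_lifts_rmult[OF \<phi>, of v p]] submodule_rmult[OF K] by blast
        then show "rmult p v \<in> {k \<in> K. \<phi> k \<in> K}" using v submodule_rmult[OF K] by auto
      qed (use submodule_0[OF K] hom_lifts_0[OF K \<phi>] submodule_subset[OF K] in auto)
      from gen[OF this] have "K \<subseteq> {k \<in> K. \<phi> k \<in> K}" using g * by blast
      then have "\<phi> k \<in> K" for k
        using hom_lifts_outside[OF \<phi>, of k] submodule_0[OF K] by (cases "k \<in> K") auto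
      then show "\<phi> \<in> hom_null r K" using \<phi> by (simp add: hom_null_def)
    qed
  next
    fix p assume "p \<in> A"
    from dual[OF this] show "\<exists>h\<in>hom_lifts r K. \<forall>q\<in>A. (case q of (i, j) \<Rightarrow> c j (h (g i))) = (if q = p then 1 else 0)"
      by (auto simp: case_prod_beta)
  qed (use A in \<open>auto simp: linear_functionalD[OF c] hsmult_def\<close>)
qed


lemma less_8_iff: "i < (8::nat) \<longleftrightarrow> i \<in> {0,1,2,3,4,5,6,7}"
  by auto

lemma lookup_mono_vec:
  "lookup3 (mono_vec (i, m) l) n = (if l = i \<and> n = m then 1 else 0)"
  by (auto simp: mono_vec_apply lookup_single)

lemma mono_vec_free: "i < r \<Longrightarrow> mono_vec (i, m) \<in> free_module r"
  by (auto simp: free_module_def mono_vec_apply)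

section \<open>An ideal of colength 12\<close>

text \<open>An index \<open>(i, a, b, c)\<close> stands for the monomial \<open>x\<^sup>ay\<^sup>bz\<^sup>c\<close> in component \<open>i\<close>. Since \<open>xz = y\<^sup>3\<close> in the
  quotient, the coordinate of \<open>y\<^sup>3\<close> is the sum of two coefficients.\<close>

definition basis12 :: "(nat \<times> nat \<times> nat \<times> nat) set" where
  "basis12 = {(0,0,0,0), (0,1,0,0), (0,0,1,0), (0,0,0,1), (0,0,2,0), (0,0,1,1), (0,0,0,2),
     (0,1,1,0), (0,0,3,0), (0,0,2,1), (0,0,1,2), (0,0,0,3)}"

definition socle12 :: "(nat \<times> nat \<times> nat \<times> nat) set" where
  "socle12 = {(0,1,1,0), (0,0,3,0), (0,0,2,1), (0,0,1,2), (0,0,0,3)}"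

definition coord12 :: "nat \<times> nat \<times> nat \<times> nat \<Rightarrow> vec3 \<Rightarrow> complex" where
  "coord12 j k = lookup3 (k 0) (snd j) + (if snd j = (0,3,0) then lookup3 (k 0) (1,0,1) else 0)"

definition K12 :: "vec3 set" where
  "K12 = {v \<in> free_module 1. \<forall>j\<in>basis12. coord12 j v = 0}"

definition gen12 :: "nat \<Rightarrow> vec3" where
  "gen12 i = [mono_vec (0,2,0,0), mono_vec (0,1,2,0), mono_vec (0,1,1,1), mono_vec (0,1,0,2),
     mono_vec (0,0,3,0) - mono_vec (0,1,0,1), mono_vec (0,0,2,2), mono_vec (0,0,1,3), mono_vec (0,0,0,4)] ! i"

text \<open>Coordinates on \<open>K / mK\<close> dual to the generators; the second summands reflect
  \<open>y\<^sup>4 = xyz + y(y\<^sup>3 - xz)\<close> and \<open>y\<^sup>3z = xz\<^sup>2 + z(y\<^sup>3 - xz)\<close>.\<close>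

definition mult12 :: "nat \<Rightarrow> vec3 \<Rightarrow> complex" where
  "mult12 i k = [lookup3 (k 0) (2,0,0), lookup3 (k 0) (1,2,0),
     lookup3 (k 0) (1,1,1) + lookup3 (k 0) (0,4,0), lookup3 (k 0) (1,0,2) + lookup3 (k 0) (0,3,1),
     lookup3 (k 0) (0,3,0), lookup3 (k 0) (0,2,2), lookup3 (k 0) (0,1,3), lookup3 (k 0) (0,0,4)] ! i"

text \<open>Every generator may go to the socle. \<open>gen12 4\<close> enters the syzygies below
  with coefficients x and z^2, hence may also go to x, y^2, yz, z^2. The last index detects d/dx
  through x z^2.\<close>

definition params12 :: "(nat \<times> nat \<times> nat \<times> nat \<times> nat) set" where
  "params12 = {..<8} \<times> socle12 \<union> {4} \<times> {(0,1,0,0), (0,0,2,0), (0,0,1,1), (0,0,0,2)} \<union> {(3, 0,0,0,2)}"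

lemma linear_coord12: "linear_functional (coord12 j)"
  by (auto simp: linear_functional_def coord12_def rmult_def lookup_add distrib_left)

lemma linear_mult12: "i < 8 \<Longrightarrow> linear_functional (mult12 i)"
  unfolding less_8_iff
  by (auto simp: linear_functional_def mult12_def rmult_def lookup_add distrib_left)

lemma submodule_K12: "is_submodule 1 K12"
  unfolding K12_def
  by (rule common_kernel_is_submodule[OF linear_coord12])
    (auto simp: basis12_def coord12_def rmult_def)

lemma coord12_mono_vec: "i \<in> basis12 \<Longrightarrow> j \<in> basis12 \<Longrightarrow> coord12 i (mono_vec j) = (if i = j then 1 else 0)"
  unfolding basis12_def by (elim insertE emptyE; simp add: coord12_def lookup_mono_vec)

lemma gen12_mem: "i < 8 \<Longrightarrow> gen12 i \<in> K12"
  unfolding less_8_iff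
  by (elim insertE emptyE; simp add: gen12_def K12_def basis12_def coord12_def lookup_mono_vec lookup_minus
      mono_vec_free submodule_diff[OF submodule_free])

lemma mult12_gen12: "i < 8 \<Longrightarrow> j < 8 \<Longrightarrow> mult12 i (gen12 j) = (if i = j then 1 else 0)"
  unfolding less_8_iff
  by (elim insertE emptyE; simp add: gen12_def mult12_def lookup_mono_vec lookup_minus)

lemma mult12_vars:
  assumes "k \<in> K12" "i < 8"
  shows "mult12 i (rmult xv k) = 0 \<and> mult12 i (rmult yv k) = 0 \<and> mult12 i (rmult zv k) = 0"
  using assms unfolding less_8_iff
  by (auto simp: K12_def basis12_def coord12_def mult12_def rmult_def add_ac)

lemma gen12_generate:
  assumes Q: "is_submodule 1 Q" and g: "\<And>i. i < 8 \<Longrightarrow> gen12 i \<in> Q"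
  shows "K12 \<subseteq> Q"
proof
  fix k assume k: "k \<in> K12"
  have gQ: "mono_vec (0,2,0,0) \<in> Q" "mono_vec (0,1,2,0) \<in> Q" "mono_vec (0,1,1,1) \<in> Q"
    "mono_vec (0,1,0,2) \<in> Q" "mono_vec (0,0,3,0) - mono_vec (0,1,0,1) \<in> Q" "mono_vec (0,0,2,2) \<in> Q"
    "mono_vec (0,0,1,3) \<in> Q" "mono_vec (0,0,0,4) \<in> Q"
    using g[of 0] g[of 1] g[of 2] g[of 3] g[of 4] g[of 5] g[of 6] g[of 7] by (simp_all add: gen12_def)
  \<comment> \<open>y^4 and y^3 z come from multiples of y^3 - xz. All monomials outside the basis
    are then available, except xz.\<close>
  have "rmult yv (gen12 4) + mono_vec (0,1,1,1) \<in> Q" "rmult zv (gen12 4) + mono_vec (0,1,0,2) \<in> Q"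
    using gQ g[of 4] by (auto intro: submodule_add[OF Q] submodule_rmult[OF Q])
  moreover have "rmult yv (gen12 4) + mono_vec (0,1,1,1) = mono_vec (0,0,4,0)"
    "rmult zv (gen12 4) + mono_vec (0,1,0,2) = mono_vec (0,0,3,1)"
    by (simp_all add: gen12_def fun_eq_iff rmult_def mono_vec_apply yv_def zv_def mult_single right_diff_distrib numeral_eq_Suc)
  ultimately have gQ': "mono_vec (0,0,4,0) \<in> Q" "mono_vec (0,0,3,1) \<in> Q" by simp_all
  note le = mono_vec_mem_if_le[OF Q]
  have mono: "mono_vec (0, a, b, c) \<in> Q" if "(0, a, b, c) \<notin> basis12" "(a, b, c) \<noteq> (1, 0, 1)" for a b c
  proof (rule ccontr)
    assume n: "mono_vec (0, a, b, c) \<notin> Q"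
    have bounds: "\<not> a \<ge> 2" "\<not> (a \<ge> 1 \<and> b \<ge> 2)" "\<not> (a \<ge> 1 \<and> b \<ge> 1 \<and> c \<ge> 1)" "\<not> (a \<ge> 1 \<and> c \<ge> 2)"
      "\<not> b \<ge> 4" "\<not> (b \<ge> 3 \<and> c \<ge> 1)" "\<not> (b \<ge> 2 \<and> c \<ge> 2)" "\<not> (b \<ge> 1 \<and> c \<ge> 3)" "\<not> c \<ge> 4"
      using n gQ gQ' by (auto dest: le[of 0 _ _ _ a b c])
    then have "a \<in> {0,1}" "b \<in> {0,1,2,3}" "c \<in> {0,1,2,3}" by auto
    then show False
      using that bounds by (elim insertE emptyE; simp add: basis12_def)
  qed
  \<comment> \<open>This clears the coefficient of y^3. Since the coordinate of y^3 also counts xz,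
    the coefficient of xz vanishes too, and only monomials in Q remain.\<close>
  let ?k = "k - rmult (const3 (lookup3 (k 0) (0,3,0))) (gen12 4)"
  have gr: "rmult (const3 (lookup3 (k 0) (0,3,0))) (gen12 4) \<in> Q"
    using g by (intro submodule_rmult[OF Q]) simp
  have k': "?k \<in> K12"
    using k gen12_mem[of 4] by (intro submodule_diff[OF submodule_K12] submodule_rmult[OF submodule_K12]) auto
  have "?k \<in> Q"
  proof (rule mem_submodule_if_monomials[OF Q])
    show "?k \<in> free_module 1" using k' by (simp add: K12_def)
    fix i :: nat and m assume i: "i < 1" and m: "lookup3 (?k i) m \<noteq> 0"
    obtain a b c where abc: "m = (a, b, c)" by (cases m)
    have k3: "lookup3 (?k 0) (0,3,0) = 0"
      by (simp add: gen12_def rmult_def lookup_minus lookup_mono_vec)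
    then have "lookup3 (?k 0) (1,0,1) = 0"
      using k' by (auto simp: K12_def basis12_def coord12_def)
    moreover have "lookup3 (?k 0) (snd j) = 0" if "j \<in> basis12" for j
      using k' k3 that by (auto simp: K12_def basis12_def coord12_def)
    ultimately have "(0, a, b, c) \<notin> basis12" "(a, b, c) \<noteq> (1, 0, 1)"
      using m i abc by force+
    from mono[OF this] show "mono_vec (i, m) \<in> Q" using i abc by simp
  qed
  then show "k \<in> Q" using submodule_diff_iff[OF Q, of k "rmult (const3 (lookup3 (k 0) (0,3,0))) (gen12 4)"] gr
    by blast
qed

text \<open>Each syzygy of the generators forces the same relation among their images in M;
  comparing coefficients gives linear equations that leave only the chosen parameters free.\<close>

lemma determined12:
  assumes \<phi>: "\<phi> \<in> hom_lifts 1 K12" and 0: "\<forall>(i, j)\<in>params12. coord12 j (\<phi> (gen12 i)) = 0" and i: "i < 8"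
  shows "\<phi> (gen12 i) \<in> K12"
proof -
  note K = submodule_K12
  have mult: "coord12 j (\<phi> (rmult p k)) = coord12 j (rmult p (\<phi> k))" if "k \<in> K12" "j \<in> basis12" for j p k
    using hom_lifts_rmult[OF \<phi> that(1), of p] that(2) linear_functionalD(5)[OF linear_coord12]
    by (simp add: K12_def)
  have add: "coord12 j (\<phi> (k + l)) = coord12 j (\<phi> k) + coord12 j (\<phi> l)" if "k \<in> K12" "l \<in> K12" "j \<in> basis12" for j k l
    using hom_lifts_add[OF \<phi> that(1,2)] that(3) linear_functionalD(5)[OF linear_coord12]
    by (simp add: K12_def diff_eq_eq add.commute)
  have syz2: "coord12 j (rmult p (\<phi> (gen12 i))) = coord12 j (rmult q (\<phi> (gen12 l)))"
    if "i < 8" "l < 8" "rmult p (gen12 i) = rmult q (gen12 l)" "j \<in> basis12" for i l p q j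
    using mult[OF gen12_mem, of i j p] mult[OF gen12_mem, of l j q] that by simp
  have syz3: "coord12 j (rmult p (\<phi> (gen12 i))) = coord12 j (rmult q (\<phi> (gen12 l))) + coord12 j (rmult s (\<phi> (gen12 m)))"
    if "i < 8" "l < 8" "m < 8" "rmult p (gen12 i) = rmult q (gen12 l) + rmult s (gen12 m)" "j \<in> basis12" for i l m p q s j
    using mult[OF gen12_mem, of i j p] mult[OF gen12_mem, of l j q] mult[OF gen12_mem, of m j s] that
      add[OF submodule_rmult[OF K gen12_mem, of l q] submodule_rmult[OF K gen12_mem, of m s], of j] by simp
  note eqs = gen12_def fun_eq_iff rmult_def mono_vec_apply xv_def yv_def zv_def mult_single right_diff_distrib
    numeral_eq_Suc
  have "rmult (yv * yv) (gen12 0) = rmult xv (gen12 1)" "rmult (yv * zv) (gen12 0) = rmult xv (gen12 2)"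
    "rmult (zv * zv) (gen12 0) = rmult xv (gen12 3)"
    "rmult zv (gen12 1) = rmult yv (gen12 2)" "rmult zv (gen12 2) = rmult yv (gen12 3)"
    "rmult xv (gen12 5) = rmult (zv * zv) (gen12 1)" "rmult xv (gen12 6) = rmult (zv * zv) (gen12 2)"
    "rmult xv (gen12 7) = rmult (zv * zv) (gen12 3)"
    "rmult zv (gen12 5) = rmult yv (gen12 6)" "rmult zv (gen12 6) = rmult yv (gen12 7)"
    by (simp_all add: eqs)
  note s2 = this[THEN syz2[rotated 2]]
  have "rmult yv (gen12 1) = rmult xv (gen12 4) + rmult zv (gen12 0)"
    "rmult yv (gen12 5) = rmult (zv * zv) (gen12 4) + rmult zv (gen12 3)"
    by (simp_all add: eqs)
  note s3 = this[THEN syz3[rotated 3]]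
  have E: "\<forall>j\<in>basis12. coord12 j (rmult (yv * yv) (\<phi> (gen12 0))) = coord12 j (rmult xv (\<phi> (gen12 1)))"
    "\<forall>j\<in>basis12. coord12 j (rmult (yv * zv) (\<phi> (gen12 0))) = coord12 j (rmult xv (\<phi> (gen12 2)))"
    "\<forall>j\<in>basis12. coord12 j (rmult (zv * zv) (\<phi> (gen12 0))) = coord12 j (rmult xv (\<phi> (gen12 3)))"
    "\<forall>j\<in>basis12. coord12 j (rmult zv (\<phi> (gen12 1))) = coord12 j (rmult yv (\<phi> (gen12 2)))"
    "\<forall>j\<in>basis12. coord12 j (rmult zv (\<phi> (gen12 2))) = coord12 j (rmult yv (\<phi> (gen12 3)))"
    "\<forall>j\<in>basis12. coord12 j (rmult xv (\<phi> (gen12 5))) = coord12 j (rmult (zv * zv) (\<phi> (gen12 1)))"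
    "\<forall>j\<in>basis12. coord12 j (rmult xv (\<phi> (gen12 6))) = coord12 j (rmult (zv * zv) (\<phi> (gen12 2)))"
    "\<forall>j\<in>basis12. coord12 j (rmult xv (\<phi> (gen12 7))) = coord12 j (rmult (zv * zv) (\<phi> (gen12 3)))"
    "\<forall>j\<in>basis12. coord12 j (rmult zv (\<phi> (gen12 5))) = coord12 j (rmult yv (\<phi> (gen12 6)))"
    "\<forall>j\<in>basis12. coord12 j (rmult zv (\<phi> (gen12 6))) = coord12 j (rmult yv (\<phi> (gen12 7)))"
    "\<forall>j\<in>basis12. coord12 j (rmult yv (\<phi> (gen12 1))) = coord12 j (rmult xv (\<phi> (gen12 4))) + coord12 j (rmult zv (\<phi> (gen12 0)))"
    "\<forall>j\<in>basis12. coord12 j (rmult yv (\<phi> (gen12 5))) = coord12 j (rmult (zv * zv) (\<phi> (gen12 4))) + coord12 j (rmult zv (\<phi> (gen12 3)))"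
    using s2 s3 by simp_all
  have Z: "\<forall>i\<in>{0,1,2,3,4,5,6,7}. \<forall>j\<in>socle12. coord12 j (\<phi> (gen12 i)) = 0"
    "coord12 (0,1,0,0) (\<phi> (gen12 4)) = 0" "coord12 (0,0,2,0) (\<phi> (gen12 4)) = 0" "coord12 (0,0,1,1) (\<phi> (gen12 4)) = 0"
    "coord12 (0,0,0,2) (\<phi> (gen12 4)) = 0" "coord12 (0,0,0,2) (\<phi> (gen12 3)) = 0"
    using 0 by (auto simp: params12_def)
  note coords = basis12_def socle12_def coord12_def rmult_def mult.assoc
  \<comment> \<open>The next three coefficients are nonzero for d/dx. The vanishing of z^2 at
    \<open>gen12 3\<close> reaches them through the coordinates z^3, then y z^2 and y^2 z, and
    finally y^3 = xz of the syzygies used.\<close>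
  have e1: "lookup3 (\<phi> (gen12 4) 0) (0,0,1) = 0" using E(12) Z(6) by (simp add: coords)
  have e2: "lookup3 (\<phi> (gen12 1) 0) (0,2,0) = 0" using E(4,5) Z(6) by (simp add: coords)
  have e3: "lookup3 (\<phi> (gen12 0) 0) (1,0,0) = 0" using E(11) e1 e2 by (simp add: coords)
  have "\<forall>i\<in>{0,1,2,3,4,5,6,7}. \<forall>j\<in>basis12. coord12 j (\<phi> (gen12 i)) = 0"
    using E Z e1 e2 e3 by (simp add: coords)
  then have "\<forall>j\<in>basis12. coord12 j (\<phi> (gen12 i)) = 0" using i unfolding less_8_iff by blast
  then show ?thesis using hom_lifts_free[OF \<phi>] by (simp add: K12_def)
qed


lemma quot_point_12: "quot_point 1 12 45 K12"
proof -
  note K = submodule_K12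
  have "quot_point 1 (card basis12) (card params12) K12"
  proof (rule quot_point_if_generators[where c = coord12 and b = mono_vec and g = gen12 and G = "{..<8}"
        and f = "xv * xv"])
    fix p assume p: "p \<in> params12"
    have pb: "fst p < 8" "snd p \<in> basis12"
      using p by (auto simp: params12_def basis12_def socle12_def)
    have dual: "\<exists>h\<in>hom_lifts 1 K12. \<forall>(i, j)\<in>params12. coord12 j (h (gen12 i)) = (if (i, j) = p then 1 else 0)"
      if "h \<in> hom_lifts 1 K12" and h: "\<And>i. i < 8 \<Longrightarrow> h (gen12 i) = (if i = fst p then mono_vec (snd p) else 0)" for h
    proof (rule bexI[OF _ that(1)], clarify)
      fix i j assume "(i, j) \<in> params12"
      then have "i < 8" "j \<in> basis12" by (auto simp: params12_def basis12_def socle12_def)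
      then show "coord12 j (h (gen12 i)) = (if (i, j) = p then 1 else 0)"
        using pb h[of i] coord12_mono_vec[of j "snd p"] linear_functionalD(4)[OF linear_coord12, of j]
        by (cases p) auto
    qed
    consider "snd p \<in> socle12" | "fst p = 4" "snd p \<in> {(0,1,0,0), (0,0,2,0), (0,0,1,1), (0,0,0,2)}" | "p = (3,0,0,0,2)"
      using p by (auto simp: params12_def)
    then show "\<exists>h\<in>hom_lifts 1 K12. \<forall>(i, j)\<in>params12. coord12 j (h (gen12 i)) = (if (i, j) = p then 1 else 0)"
    proof cases
      case 1
      have "rmult xv (mono_vec (snd p)) \<in> K12 \<and> rmult yv (mono_vec (snd p)) \<in> K12 \<and> rmult zv (mono_vec (snd p)) \<in> K12"
        using 1 by (auto simp: socle12_def K12_def basis12_def coord12_def free_module_def rmult_def lookup_single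
          mono_vec_apply)
      then have "hom_on K12 (\<lambda>k. rmult (const3 (mult12 (fst p) k)) (mono_vec (snd p))) \<in> hom_lifts 1 K12"
        using 1 pb mono_vec_free[of 0 1 "snd (snd p)"]
        by (intro socle_hom_in_hom_lifts[OF K] linear_mult12 mult12_vars) (auto simp: socle12_def)
      then show ?thesis
        by (rule dual) (use pb in \<open>auto simp: gen12_mem mult12_gen12 rmult_simps\<close>)
    next
      case 2
      \<comment> \<open>The multiples of y^3 - xz by y and z are seen at y^4 and y^3 z.\<close>
      let ?ly = "\<lambda>k. lookup3 (k 0) (0,4,0)" and ?lz = "\<lambda>k. lookup3 (k 0) (0,3,1)"
      have b: "rmult xv (mono_vec (snd p)) \<in> K12 \<and> rmult (yv * yv) (mono_vec (snd p)) \<in> K12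
          \<and> rmult (yv * zv) (mono_vec (snd p)) \<in> K12 \<and> rmult (zv * zv) (mono_vec (snd p)) \<in> K12"
        using 2 by (auto simp: K12_def basis12_def coord12_def free_module_def rmult_def lookup_single
          mono_vec_apply mult.assoc)
      have hom: "hom_on K12 (\<lambda>k. rmult (const3 (mult12 4 k) + const3 (?ly k) * yv + const3 (?lz k) * zv) (mono_vec (snd p)))
          \<in> hom_lifts 1 K12"
      proof (intro functional_hom_in_hom_lifts[OF K] linear_mult12 mult12_vars)
        show "mono_vec (snd p) \<in> free_module 1" using 2 by (auto simp: mono_vec_free)
        show "linear_functional ?ly" "linear_functional ?lz"
          by (simp_all add: linear_functional_def lookup_add rmult_def)
      qed (use b in \<open>auto simp: K12_def basis12_def coord12_def mult12_def rmult_def\<close>)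
      have l0: "?ly (gen12 i) = 0 \<and> ?lz (gen12 i) = 0" if "i < 8" for i
        using that unfolding less_8_iff
        by (elim insertE emptyE; simp add: gen12_def lookup_mono_vec lookup_minus)
      show ?thesis
        by (rule dual[OF hom]) (use 2 in \<open>auto simp: gen12_mem mult12_gen12 rmult_simps l0[unfolded One_nat_def]\<close>)
    next
      case 3
      show ?thesis
      proof (rule bexI[OF _ dx_hom_in_hom_lifts[OF K]], clarify)
        \<comment> \<open>d/dx takes the generators to 2x, y^2, yz, z^2, -z, 0, 0, 0; of these only
          z^2, at generator 3, meets \<open>params12\<close>.\<close>
        fix i j assume ij: "(i, j) \<in> params12"
        then have "hom_on K12 (\<lambda>k i. dx (k i)) (gen12 i) = (\<lambda>l. dx (gen12 i l))"
          by (intro hom_on_apply gen12_mem) (auto simp: params12_def)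
        then show "coord12 j (hom_on K12 (\<lambda>k i. dx (k i)) (gen12 i)) = (if (i, j) = p then 1 else 0)"
          using ij unfolding 3 params12_def socle12_def lessThan_def less_8_iff
          by (auto simp: coord12_def gen12_def lookup_mono_vec lookup_minus)
      qed
    qed
  next
    \<comment> \<open>x^2 lies in the ideal, and its only zero on the axis is the origin.\<close>
    show "rmult (xv * xv) v \<in> K12" if "v \<in> free_module 1" for v
      using submodule_rmult[OF submodule_free that, of "xv * xv"]
      by (auto simp: K12_def) (auto simp: basis12_def coord12_def rmult_def mult.assoc)
    show "params12 \<subseteq> {..<8} \<times> basis12" by (auto simp: params12_def basis12_def socle12_def)
    show "finite basis12" "finite params12" by (simp_all add: basis12_def params12_def socle12_def)
    show "mono_vec j \<in> free_module 1 \<and> (\<forall>i\<in>basis12. coord12 i (mono_vec j) = (if i = j then 1 else 0))"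
      if "j \<in> basis12" for j
      using that by (auto simp: coord12_mono_vec) (auto simp: basis12_def mono_vec_free)
  qed (use K gen12_mem gen12_generate determined12 linear_coord12 in \<open>auto simp: K12_def\<close>)
  moreover have "card basis12 = 12" by (simp add: basis12_def)
  moreover have "card params12 = 45"
    by (auto simp: params12_def socle12_def card_Un_disjoint card_cartesian_product)
  ultimately show ?thesis by simp
qed

section \<open>A rank two quotient of length 8\<close>

definition basis8 :: "(nat \<times> nat \<times> nat \<times> nat) set" where
  "basis8 = {(0,0,0,0), (0,1,0,0), (0,0,1,0), (0,0,0,1), (0,0,2,0), (0,0,1,1), (0,0,0,2), (1,0,0,0)}"

definition socle8 :: "(nat \<times> nat \<times> nat \<times> nat) set" where
  "socle8 = {(0,1,0,0), (0,0,2,0), (0,0,1,1), (0,0,0,2)}"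

text \<open>Component 0 belongs to e and component 1 to f. As yf = xe and zf = y^2 e in M, the
  coefficients of yf and zf count towards xe and y^2 e.\<close>

definition coord8 :: "nat \<times> nat \<times> nat \<times> nat \<Rightarrow> vec3 \<Rightarrow> complex" where
  "coord8 j k = lookup3 (k (fst j)) (snd j) + (if j = (0,1,0,0) then lookup3 (k 1) (0,1,0) else 0)
     + (if j = (0,0,2,0) then lookup3 (k 1) (0,0,1) else 0)"

definition K8 :: "vec3 set" where
  "K8 = {v \<in> free_module 2. \<forall>j\<in>basis8. coord8 j v = 0}"

definition gen8 :: "nat \<Rightarrow> vec3" where
  "gen8 i = [mono_vec (1,1,0,0), mono_vec (1,0,1,0) - mono_vec (0,1,0,0), mono_vec (1,0,0,1) - mono_vec (0,0,2,0),
     mono_vec (0,1,1,0), mono_vec (0,1,0,1), mono_vec (0,0,2,1), mono_vec (0,0,1,2), mono_vec (0,0,0,3)] ! i"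

text \<open>Coordinates on K/mK dual to the generators. The additional summands come from y^2 f = y
  g1 + g3, yzf = z g1 + g4, y^3 e = z g1 - y g2 + g4 and z^2 f = z g2 + g5, where gi is
  \<open>gen8 i\<close>.\<close>

definition mult8 :: "nat \<Rightarrow> vec3 \<Rightarrow> complex" where
  "mult8 i k = [lookup3 (k 1) (1,0,0), lookup3 (k 1) (0,1,0), lookup3 (k 1) (0,0,1),
     lookup3 (k 0) (1,1,0) + lookup3 (k 1) (0,2,0),
     lookup3 (k 0) (1,0,1) + lookup3 (k 1) (0,1,1) + lookup3 (k 0) (0,3,0),
     lookup3 (k 0) (0,2,1) + lookup3 (k 1) (0,0,2), lookup3 (k 0) (0,1,2), lookup3 (k 0) (0,0,3)] ! i"

text \<open>Besides the socle values, \<open>gen8 1\<close> and \<open>gen8 2\<close> may go to ye,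
  ze and f, which are killed by x and by all quadratic monomials in y, z. The last index detects
  d/dx through xz e.\<close>

definition params8 :: "(nat \<times> nat \<times> nat \<times> nat \<times> nat) set" where
  "params8 = {..<8} \<times> socle8 \<union> {1, 2} \<times> {(0,0,1,0), (0,0,0,1), (1,0,0,0)} \<union> {(4, 0,0,0,1)}"

lemma linear_coord8: "linear_functional (coord8 j)"
  by (auto simp: linear_functional_def coord8_def rmult_def lookup_add distrib_left)

lemma linear_mult8: "i < 8 \<Longrightarrow> linear_functional (mult8 i)"
  unfolding less_8_iff
  by (auto simp: linear_functional_def mult8_def rmult_def lookup_add distrib_left)

lemma submodule_K8: "is_submodule 2 K8"
  unfolding K8_def
  by (rule common_kernel_is_submodule[OF linear_coord8])
    (auto simp: basis8_def coord8_def rmult_def)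

lemma coord8_mono_vec: "i \<in> basis8 \<Longrightarrow> j \<in> basis8 \<Longrightarrow> coord8 i (mono_vec j) = (if i = j then 1 else 0)"
  unfolding basis8_def by (elim insertE emptyE; simp add: coord8_def lookup_mono_vec)

lemma gen8_mem: "i < 8 \<Longrightarrow> gen8 i \<in> K8"
  unfolding less_8_iff
  by (elim insertE emptyE; simp add: gen8_def K8_def basis8_def coord8_def lookup_mono_vec lookup_minus
      mono_vec_free submodule_diff[OF submodule_free])

lemma mult8_gen8: "i < 8 \<Longrightarrow> j < 8 \<Longrightarrow> mult8 i (gen8 j) = (if i = j then 1 else 0)"
  unfolding less_8_iff
  by (elim insertE emptyE; simp add: gen8_def mult8_def lookup_mono_vec lookup_minus)

lemma mult8_vars:
  assumes "k \<in> K8" "i < 8"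
  shows "mult8 i (rmult xv k) = 0 \<and> mult8 i (rmult yv k) = 0 \<and> mult8 i (rmult zv k) = 0"
  using assms unfolding less_8_iff
  by (auto simp: K8_def basis8_def coord8_def mult8_def rmult_def add_ac)

lemma gen8_generate:
  assumes Q: "is_submodule 2 Q" and g: "\<And>i. i < 8 \<Longrightarrow> gen8 i \<in> Q"
  shows "K8 \<subseteq> Q"
proof
  fix k assume k: "k \<in> K8"
  have gQ: "mono_vec (1,1,0,0) \<in> Q" "mono_vec (0,1,1,0) \<in> Q" "mono_vec (0,1,0,1) \<in> Q"
    "mono_vec (0,0,2,1) \<in> Q" "mono_vec (0,0,1,2) \<in> Q" "mono_vec (0,0,0,3) \<in> Q"
    using g[of 0] g[of 3] g[of 4] g[of 5] g[of 6] g[of 7] by (simp_all add: gen8_def)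
  \<comment> \<open>These combinations are the missing monomials x^2 e, y^3 e, y^2 f, yz f and z^2
    f.\<close>
  have "rmult yv (gen8 0) - rmult xv (gen8 1) \<in> Q" "rmult zv (gen8 1) - rmult yv (gen8 2) + gen8 4 \<in> Q"
    "rmult yv (gen8 1) + gen8 3 \<in> Q" "rmult zv (gen8 1) + gen8 4 \<in> Q" "rmult zv (gen8 2) + gen8 5 \<in> Q"
    using g by (auto intro!: submodule_add[OF Q] submodule_diff[OF Q] submodule_rmult[OF Q])
  moreover have "rmult yv (gen8 0) - rmult xv (gen8 1) = mono_vec (0,2,0,0)"
    "rmult zv (gen8 1) - rmult yv (gen8 2) + gen8 4 = mono_vec (0,0,3,0)"
    "rmult yv (gen8 1) + gen8 3 = mono_vec (1,0,2,0)" "rmult zv (gen8 1) + gen8 4 = mono_vec (1,0,1,1)"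
    "rmult zv (gen8 2) + gen8 5 = mono_vec (1,0,0,2)"
    by (simp_all add: gen8_def fun_eq_iff rmult_def mono_vec_apply xv_def yv_def zv_def mult_single
        right_diff_distrib numeral_eq_Suc)
  ultimately have gQ': "mono_vec (0,2,0,0) \<in> Q" "mono_vec (0,0,3,0) \<in> Q" "mono_vec (1,0,2,0) \<in> Q"
    "mono_vec (1,0,1,1) \<in> Q" "mono_vec (1,0,0,2) \<in> Q" by simp_all
  note le = mono_vec_mem_if_le[OF Q]
  have mono0: "mono_vec (0, a, b, c) \<in> Q" if "(0, a, b, c) \<notin> basis8" for a b c
  proof (rule ccontr)
    assume n: "mono_vec (0, a, b, c) \<notin> Q"
    have bounds: "\<not> a \<ge> 2" "\<not> (a \<ge> 1 \<and> b \<ge> 1)" "\<not> (a \<ge> 1 \<and> c \<ge> 1)"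
      "\<not> b \<ge> 3" "\<not> (b \<ge> 2 \<and> c \<ge> 1)" "\<not> (b \<ge> 1 \<and> c \<ge> 2)" "\<not> c \<ge> 3"
      using n gQ gQ' by (auto dest: le[of 0 _ _ _ a b c])
    then have "a \<in> {0,1}" "b \<in> {0,1,2}" "c \<in> {0,1,2}" by auto
    then show False
      using that bounds by (elim insertE emptyE; simp add: basis8_def)
  qed
  have mono1: "mono_vec (1, a, b, c) \<in> Q" if "(a, b, c) \<notin> {(0,0,0), (0,1,0), (0,0,1)}" for a b c
  proof (rule ccontr)
    assume n: "mono_vec (1, a, b, c) \<notin> Q"
    have bounds: "\<not> a \<ge> 1" "\<not> b \<ge> 2" "\<not> (b \<ge> 1 \<and> c \<ge> 1)" "\<not> c \<ge> 2"
      using n gQ gQ' by (auto dest: le[of "Suc 0" _ _ _ a b c])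
    then have "a \<in> {0}" "b \<in> {0,1}" "c \<in> {0,1}" by auto
    then show False
      using that bounds by (elim insertE emptyE; simp)
  qed
  \<comment> \<open>Subtracting this clears yf and zf, after which the coordinates of the remainder
    are plain coefficients.\<close>
  let ?g = "rmult (const3 (lookup3 (k 1) (0,1,0))) (gen8 1) + rmult (const3 (lookup3 (k 1) (0,0,1))) (gen8 2)"
  have gr: "?g \<in> Q"
    using g by (intro submodule_add[OF Q] submodule_rmult[OF Q]) simp_all
  have k': "k - ?g \<in> K8"
    using k gen8_mem
    by (intro submodule_diff[OF submodule_K8] submodule_add[OF submodule_K8] submodule_rmult[OF submodule_K8]) auto
  have "k - ?g \<in> Q"
  proof (rule mem_submodule_if_monomials[OF Q])
    show "k - ?g \<in> free_module 2" using k' by (simp add: K8_def)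
    fix i :: nat and m assume i: "i < 2" and m: "lookup3 ((k - ?g) i) m \<noteq> 0"
    obtain a b c where abc: "m = (a, b, c)" by (cases m)
    have k1: "lookup3 ((k - ?g) 1) (0,1,0) = 0" "lookup3 ((k - ?g) 1) (0,0,1) = 0"
      by (simp_all add: gen8_def rmult_def lookup_minus lookup_add lookup_mono_vec)
    have k0: "lookup3 ((k - ?g) (fst j)) (snd j) = 0" if "j \<in> basis8" for j
    proof -
      have "coord8 j (k - ?g) = 0" using k' that by (simp add: K8_def)
      then show ?thesis unfolding coord8_def k1 by simp
    qed
    from i consider "i = 0" | "i = 1" by linarith
    then show "mono_vec (i, m) \<in> Q"
    proof cases
      case 1
      then have "(0, a, b, c) \<notin> basis8" using m abc k0 by force
      from mono0[OF this] 1 abc show ?thesis by simp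
    next
      case 2
      have notin: "(a, b, c) \<notin> {(0,0,0), (0,1,0), (0,0,1)}"
        if "lookup3 v (0,1,0) = 0" "lookup3 v (0,0,1) = 0" "lookup3 v (0,0,0) = 0" "lookup3 v (a, b, c) \<noteq> 0" for v
        using that by (intro notI, elim insertE emptyE) auto
      have "lookup3 ((k - ?g) 1) (0,0,0) = 0" using k0[of "(1,0,0,0)"] by (simp add: basis8_def)
      moreover have "lookup3 ((k - ?g) 1) (a, b, c) \<noteq> 0" using m abc 2 by (simp only: not_False_eq_True)
      ultimately have "(a, b, c) \<notin> {(0,0,0), (0,1,0), (0,0,1)}" by (rule notin[OF k1])
      from mono1[OF this] 2 abc show ?thesis by simp
    qed
  qed
  then show "k \<in> Q" using submodule_diff_iff[OF Q, of k ?g] gr by blast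
qed

text \<open>As for the ideal, syzygies become linear equations in M. The one with four terms
  expresses y z^2 f both through yzf and through z^2 f.\<close>

lemma determined8:
  assumes \<phi>: "\<phi> \<in> hom_lifts 2 K8" and 0: "\<forall>(i, j)\<in>params8. coord8 j (\<phi> (gen8 i)) = 0" and i: "i < 8"
  shows "\<phi> (gen8 i) \<in> K8"
proof -
  note K = submodule_K8
  have mult: "coord8 j (\<phi> (rmult p k)) = coord8 j (rmult p (\<phi> k))" if "k \<in> K8" "j \<in> basis8" for j p k
    using hom_lifts_rmult[OF \<phi> that(1), of p] that(2) linear_functionalD(5)[OF linear_coord8]
    by (simp add: K8_def)
  have add: "coord8 j (\<phi> (k + l)) = coord8 j (\<phi> k) + coord8 j (\<phi> l)" if "k \<in> K8" "l \<in> K8" "j \<in> basis8" for j k l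
    using hom_lifts_add[OF \<phi> that(1,2)] that(3) linear_functionalD(5)[OF linear_coord8]
    by (simp add: K8_def diff_eq_eq add.commute)
  have mult_add: "coord8 j (\<phi> (rmult p (gen8 i) + rmult q (gen8 l)))
      = coord8 j (rmult p (\<phi> (gen8 i))) + coord8 j (rmult q (\<phi> (gen8 l)))"
    if "i < 8" "l < 8" "j \<in> basis8" for i l p q j
    using mult[OF gen8_mem, of i j p] mult[OF gen8_mem, of l j q] that
      add[OF submodule_rmult[OF K gen8_mem, of i p] submodule_rmult[OF K gen8_mem, of l q], of j] by simp
  have syz2: "coord8 j (rmult p (\<phi> (gen8 i))) = coord8 j (rmult q (\<phi> (gen8 l)))"
    if "i < 8" "l < 8" "rmult p (gen8 i) = rmult q (gen8 l)" "j \<in> basis8" for i l p q j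
    using mult[OF gen8_mem, of i j p] mult[OF gen8_mem, of l j q] that by simp
  have syz3: "coord8 j (rmult p (\<phi> (gen8 i))) = coord8 j (rmult q (\<phi> (gen8 l))) + coord8 j (rmult s (\<phi> (gen8 m)))"
    if "i < 8" "l < 8" "m < 8" "rmult p (gen8 i) = rmult q (gen8 l) + rmult s (gen8 m)" "j \<in> basis8" for i l m p q s j
    using mult[OF gen8_mem, of i j p] mult_add[of l m j q s] that by simp
  have syz4: "coord8 j (rmult p (\<phi> (gen8 i))) + coord8 j (rmult p' (\<phi> (gen8 i')))
      = coord8 j (rmult q (\<phi> (gen8 l))) + coord8 j (rmult s (\<phi> (gen8 m)))"
    if "i < 8" "i' < 8" "l < 8" "m < 8"
      "rmult p (gen8 i) + rmult p' (gen8 i') = rmult q (gen8 l) + rmult s (gen8 m)" "j \<in> basis8" for i i' l m p p' q s j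
    using mult_add[of i i' j p p'] mult_add[of l m j q s] that by simp
  note eqs = gen8_def fun_eq_iff rmult_def mono_vec_apply xv_def yv_def zv_def mult_single right_diff_distrib
    numeral_eq_Suc
  have "rmult zv (gen8 3) = rmult yv (gen8 4)" "rmult zv (gen8 5) = rmult yv (gen8 6)"
    "rmult zv (gen8 6) = rmult yv (gen8 7)" "rmult xv (gen8 5) = rmult (yv * zv) (gen8 3)"
    "rmult xv (gen8 6) = rmult (yv * zv) (gen8 4)" "rmult xv (gen8 7) = rmult (zv * zv) (gen8 4)"
    by (simp_all add: eqs)
  note s2 = this[THEN syz2[rotated 2]]
  have "rmult (yv * yv) (gen8 0) = rmult (xv * yv) (gen8 1) + rmult xv (gen8 3)"
    "rmult (yv * zv) (gen8 0) = rmult (xv * zv) (gen8 1) + rmult xv (gen8 4)"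
    "rmult zv (gen8 0) = rmult xv (gen8 2) + rmult yv (gen8 3)"
    by (simp_all add: eqs)
  note s3 = this[THEN syz3[rotated 3]]
  have "rmult (zv * zv) (gen8 1) + rmult zv (gen8 4) = rmult (yv * zv) (gen8 2) + rmult yv (gen8 5)"
    by (simp add: eqs)
  note s4 = this[THEN syz4[rotated 4]]
  have E: "\<forall>j\<in>basis8. coord8 j (rmult zv (\<phi> (gen8 3))) = coord8 j (rmult yv (\<phi> (gen8 4)))"
    "\<forall>j\<in>basis8. coord8 j (rmult zv (\<phi> (gen8 5))) = coord8 j (rmult yv (\<phi> (gen8 6)))"
    "\<forall>j\<in>basis8. coord8 j (rmult zv (\<phi> (gen8 6))) = coord8 j (rmult yv (\<phi> (gen8 7)))"
    "\<forall>j\<in>basis8. coord8 j (rmult xv (\<phi> (gen8 5))) = coord8 j (rmult (yv * zv) (\<phi> (gen8 3)))"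
    "\<forall>j\<in>basis8. coord8 j (rmult xv (\<phi> (gen8 6))) = coord8 j (rmult (yv * zv) (\<phi> (gen8 4)))"
    "\<forall>j\<in>basis8. coord8 j (rmult xv (\<phi> (gen8 7))) = coord8 j (rmult (zv * zv) (\<phi> (gen8 4)))"
    "\<forall>j\<in>basis8. coord8 j (rmult (yv * yv) (\<phi> (gen8 0))) = coord8 j (rmult (xv * yv) (\<phi> (gen8 1))) + coord8 j (rmult xv (\<phi> (gen8 3)))"
    "\<forall>j\<in>basis8. coord8 j (rmult (yv * zv) (\<phi> (gen8 0))) = coord8 j (rmult (xv * zv) (\<phi> (gen8 1))) + coord8 j (rmult xv (\<phi> (gen8 4)))"
    "\<forall>j\<in>basis8. coord8 j (rmult zv (\<phi> (gen8 0))) = coord8 j (rmult xv (\<phi> (gen8 2))) + coord8 j (rmult yv (\<phi> (gen8 3)))"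
    "\<forall>j\<in>basis8. coord8 j (rmult (zv * zv) (\<phi> (gen8 1))) + coord8 j (rmult zv (\<phi> (gen8 4)))
      = coord8 j (rmult (yv * zv) (\<phi> (gen8 2))) + coord8 j (rmult yv (\<phi> (gen8 5)))"
    using s2 s3 s4 by simp_all
  have Z: "\<forall>i\<in>{0,1,2,3,4,5,6,7}. \<forall>j\<in>socle8. coord8 j (\<phi> (gen8 i)) = 0"
    "\<forall>i\<in>{1,2}. \<forall>j\<in>{(0,0,1,0), (0,0,0,1), (1,0,0,0)}. coord8 j (\<phi> (gen8 i)) = 0"
    "coord8 (0,0,0,1) (\<phi> (gen8 4)) = 0"
    using 0 by (auto simp: params8_def)
  note coords = basis8_def socle8_def coord8_def rmult_def mult.assoc
  have "\<forall>i\<in>{0,1,2,3,4,5,6,7}. \<forall>j\<in>basis8. coord8 j (\<phi> (gen8 i)) = 0"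
    using E Z by (simp add: coords)
  then have "\<forall>j\<in>basis8. coord8 j (\<phi> (gen8 i)) = 0" using i unfolding less_8_iff by blast
  then show ?thesis using hom_lifts_free[OF \<phi>] by (simp add: K8_def)
qed

lemma quot_point_8: "quot_point 2 8 39 K8"
proof -
  note K = submodule_K8
  have "quot_point 2 (card basis8) (card params8) K8"
  proof (rule quot_point_if_generators[where c = coord8 and b = mono_vec and g = gen8 and G = "{..<8}"
        and f = "xv * xv"])
    fix p assume p: "p \<in> params8"
    have pb: "fst p < 8" "snd p \<in> basis8"
      using p by (auto simp: params8_def basis8_def socle8_def)
    have dual: "\<exists>h\<in>hom_lifts 2 K8. \<forall>(i, j)\<in>params8. coord8 j (h (gen8 i)) = (if (i, j) = p then 1 else 0)"
      if "h \<in> hom_lifts 2 K8" and h: "\<And>i. i < 8 \<Longrightarrow> h (gen8 i) = (if i = fst p then mono_vec (snd p) else 0)" for h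
    proof (rule bexI[OF _ that(1)], clarify)
      fix i j assume "(i, j) \<in> params8"
      then have "i < 8" "j \<in> basis8" by (auto simp: params8_def basis8_def socle8_def)
      then show "coord8 j (h (gen8 i)) = (if (i, j) = p then 1 else 0)"
        using pb h[of i] coord8_mono_vec[of j "snd p"] linear_functionalD(4)[OF linear_coord8, of j]
        by (cases p) auto
    qed
    have dual2: "\<exists>h\<in>hom_lifts 2 K8. \<forall>(i, j)\<in>params8. coord8 j (h (gen8 i)) = (if (i, j) = p then 1 else 0)"
      if s: "snd p \<in> {(0,0,1,0), (0,0,0,1), (1,0,0,0)}" and lin: "linear_functional ly" "linear_functional lz"
        and ly: "\<And>k. k \<in> K8 \<Longrightarrow> ly (rmult xv k) = 0 \<and> ly (rmult yv k) = mult8 (fst p) k \<and> ly (rmult zv k) = 0"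
        and lz: "\<And>k. k \<in> K8 \<Longrightarrow> lz (rmult xv k) = 0 \<and> lz (rmult yv k) = 0 \<and> lz (rmult zv k) = mult8 (fst p) k"
        and l0: "\<And>i. i < 8 \<Longrightarrow> ly (gen8 i) = 0 \<and> lz (gen8 i) = 0" for ly lz
    proof -
      have b: "rmult xv (mono_vec (snd p)) \<in> K8 \<and> rmult (yv * yv) (mono_vec (snd p)) \<in> K8
          \<and> rmult (yv * zv) (mono_vec (snd p)) \<in> K8 \<and> rmult (zv * zv) (mono_vec (snd p)) \<in> K8"
        using s by (auto simp: K8_def basis8_def coord8_def free_module_def rmult_def lookup_single
          mono_vec_apply mult.assoc)
      have hom: "hom_on K8 (\<lambda>k. rmult (const3 (mult8 (fst p) k) + const3 (ly k) * yv + const3 (lz k) * zv) (mono_vec (snd p)))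
          \<in> hom_lifts 2 K8"
        using s b by (intro functional_hom_in_hom_lifts[OF K] linear_mult8 mult8_vars pb lin ly lz) (auto simp: mono_vec_free)
      show ?thesis
        by (rule dual[OF hom]) (use pb in \<open>auto simp: gen8_mem mult8_gen8 rmult_simps l0\<close>)
    qed
    consider "snd p \<in> socle8" | "fst p = 1" "snd p \<in> {(0,0,1,0), (0,0,0,1), (1,0,0,0)}"
      | "fst p = 2" "snd p \<in> {(0,0,1,0), (0,0,0,1), (1,0,0,0)}" | "p = (4,0,0,0,1)"
      using p by (auto simp: params8_def)
    then show "\<exists>h\<in>hom_lifts 2 K8. \<forall>(i, j)\<in>params8. coord8 j (h (gen8 i)) = (if (i, j) = p then 1 else 0)"
    proof cases
      case 1
      have "rmult xv (mono_vec (snd p)) \<in> K8 \<and> rmult yv (mono_vec (snd p)) \<in> K8 \<and> rmult zv (mono_vec (snd p)) \<in> K8"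
        using 1 by (auto simp: socle8_def K8_def basis8_def coord8_def free_module_def rmult_def lookup_single
          mono_vec_apply)
      then have "hom_on K8 (\<lambda>k. rmult (const3 (mult8 (fst p) k)) (mono_vec (snd p))) \<in> hom_lifts 2 K8"
        using 1 pb mono_vec_free[of 0 2 "snd (snd p)"]
        by (intro socle_hom_in_hom_lifts[OF K] linear_mult8 mult8_vars) (auto simp: socle8_def)
      then show ?thesis
        by (rule dual) (use pb in \<open>auto simp: gen8_mem mult8_gen8 rmult_simps\<close>)
    next
      case 2
      \<comment> \<open>The y- and z-multiples of \<open>gen8 1\<close>: y times it occurs in y^2 f,
        z times it in both yzf and y^3 e.\<close>
      let ?ly = "\<lambda>k. lookup3 (k 1) (0,2,0)" and ?lz = "\<lambda>k. lookup3 (k 1) (0,1,1) + lookup3 (k 0) (0,3,0)"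
      show ?thesis
      proof (rule dual2[of ?ly ?lz])
        show "linear_functional ?ly" "linear_functional ?lz"
          by (simp_all add: linear_functional_def lookup_add rmult_def distrib_left)
        show "?ly (gen8 i) = 0 \<and> ?lz (gen8 i) = 0" if "i < 8" for i
          using that unfolding less_8_iff
          by (elim insertE emptyE; simp add: gen8_def lookup_mono_vec lookup_minus)
      qed (use 2 in \<open>auto simp: K8_def basis8_def coord8_def mult8_def rmult_def add_ac\<close>)
    next
      case 3
      \<comment> \<open>For \<open>gen8 2\<close> the sign comes from y^3 e = z g1 - y g2 + g4, with
        gi for \<open>gen8 i\<close>; its z-multiple is seen at z^2 f.\<close>
      let ?ly = "\<lambda>k. - lookup3 (k 0) (0,3,0)" and ?lz = "\<lambda>k. lookup3 (k 1) (0,0,2)"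
      show ?thesis
      proof (rule dual2[of ?ly ?lz])
        show "linear_functional ?ly" "linear_functional ?lz"
          by (simp_all add: linear_functional_def lookup_add rmult_def)
        show "?ly (gen8 i) = 0 \<and> ?lz (gen8 i) = 0" if "i < 8" for i
          using that unfolding less_8_iff
          by (elim insertE emptyE; simp add: gen8_def lookup_mono_vec lookup_minus)
      qed (use 3 in \<open>auto simp: K8_def basis8_def coord8_def mult8_def rmult_def add_eq_0_iff\<close>)
    next
      case 4
      show ?thesis
      proof (rule bexI[OF _ dx_hom_in_hom_lifts[OF K]], clarify)
        \<comment> \<open>d/dx takes the generators to f, -e, 0, ye, ze, 0, 0, 0; only ze, at
          generator 4, meets \<open>params8\<close>.\<close>
        fix i j assume ij: "(i, j) \<in> params8"
        then have "hom_on K8 (\<lambda>k i. dx (k i)) (gen8 i) = (\<lambda>l. dx (gen8 i l))"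
          by (intro hom_on_apply gen8_mem) (auto simp: params8_def)
        then show "coord8 j (hom_on K8 (\<lambda>k i. dx (k i)) (gen8 i)) = (if (i, j) = p then 1 else 0)"
          using ij unfolding 4 params8_def socle8_def lessThan_def less_8_iff
          by (auto simp: coord8_def gen8_def lookup_mono_vec lookup_minus)
      qed
    qed
  next
    show "rmult (xv * xv) v \<in> K8" if "v \<in> free_module 2" for v
      using submodule_rmult[OF submodule_free that, of "xv * xv"]
      by (auto simp: K8_def) (auto simp: basis8_def coord8_def rmult_def mult.assoc)
    show "params8 \<subseteq> {..<8} \<times> basis8" by (auto simp: params8_def basis8_def socle8_def)
    show "finite basis8" "finite params8" by (simp_all add: basis8_def params8_def socle8_def)
    show "mono_vec j \<in> free_module 2 \<and> (\<forall>i\<in>basis8. coord8 i (mono_vec j) = (if i = j then 1 else 0))"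
      if "j \<in> basis8" for j
      using that by (auto simp: coord8_mono_vec) (auto simp: basis8_def mono_vec_free)
  qed (use K gen8_mem gen8_generate determined8 linear_coord8 in \<open>auto simp: K8_def\<close>)
  moreover have "card basis8 = 8" by (simp add: basis8_def)
  moreover have "card params8 = 39"
    by (auto simp: params8_def socle8_def card_Un_disjoint card_cartesian_product)
  ultimately show ?thesis by simp
qed

section \<open>Counterexamples for all lengths\<close>

lemma quot_point_add_rank:
  assumes "quot_point r d n K"
  shows "\<exists>K' n'. quot_point (r + m) d n' K' \<and> (odd (n' + (r + m) * d) \<longleftrightarrow> odd (n + r * d))"
proof (induction m)
  case 0
  then show ?case using assms by auto
next
  case (Suc m)
  then obtain K' n' where "quot_point (r + m) d n' K'" and odd: "odd (n' + (r + m) * d) \<longleftrightarrow> odd (n + r * d)"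
    by blast
  then obtain K'' where "quot_point (Suc (r + m)) d (n' + d) K''"
    using quot_point_Suc_rank by blast
  moreover have "odd (n' + d + Suc (r + m) * d) \<longleftrightarrow> odd (n' + (r + m) * d)" by auto
  ultimately show ?case using odd by (metis add_Suc_right)
qed

lemma quot_point_add_length:
  assumes "quot_point r d n K" "r > 0"
  shows "\<exists>K' n'. quot_point r (d + m) n' K' \<and> (odd (n' + r * (d + m)) \<longleftrightarrow> odd (n + r * d))"
proof (induction m)
  case 0
  then show ?case using assms by auto
next
  case (Suc m)
  then obtain K' n' where "quot_point r (d + m) n' K'" and odd: "odd (n' + r * (d + m)) \<longleftrightarrow> odd (n + r * d)"
    by blast
  then obtain K'' where "quot_point r (Suc (d + m)) (n' + r + 2) K''"
    using quot_point_Suc_length assms(2) by blast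
  moreover have "odd (n' + r + 2 + r * Suc (d + m)) \<longleftrightarrow> odd (n' + r * (d + m))" by auto
  ultimately show ?case using odd by (metis add_Suc_right)
qed

theorem theoremA:
  fixes r d :: nat
  assumes "r > 0" and "d > 0"
  assumes "(r = 1 \<and> d \<ge> 12) \<or> (r \<ge> 2 \<and> d \<ge> 8)"
  shows "\<exists>K. is_submodule r K \<and> quot_dim vsmult (free_module r) K d \<and>
           (\<exists>n. quot_dim hsmult (hom_lifts r K) (hom_null r K) n \<and> odd (n + r * d))"
proof -
  \<comment> \<open>The rank is brought up to r at the minimal length, 12 or 8; points are added
    afterwards until the length is d.\<close>
  have "\<exists>d0 n K. quot_point r d0 n K \<and> odd (n + r * d0) \<and> d0 \<le> d"
    using assms(3)
  proof
    assume "r = 1 \<and> d \<ge> 12"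
    then show ?thesis using quot_point_12 by (intro exI[of _ 12] exI[of _ 45] exI[of _ K12]) auto
  next
    assume r: "r \<ge> 2 \<and> d \<ge> 8"
    then have "2 + (r - 2) = r" by linarith
    then obtain K n where "quot_point r 8 n K" "odd (n + r * 8)"
      using quot_point_add_rank[OF quot_point_8, of "r - 2"] by (auto simp del: add_2_eq_Suc)
    then show ?thesis using r by blast
  qed
  then obtain d0 n K where "quot_point r d0 n K" and "odd (n + r * d0)" and "d0 \<le> d" by blast
  then obtain K' n' where "quot_point r d n' K'" "odd (n' + r * d)"
    using quot_point_add_length[of r d0 n K "d - d0"] assms(1) by auto
  then show ?thesis unfolding quot_point_def by blast
qed

end
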